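(* Let $n$ be a positive integer, let $x_1\ge\cdots\ge x_{n+1}$ be real numbers, and put $u_i=x_i-x_{i+1}$ for $i=1,\dots,n$. The volume of the permutohedron $P_{n+1}=P_{n+1}(x_1,\dots,x_{n+1})$ is given by the following polynomial in the variables $u_1,\dots,u_n$: $$\mathrm{Vol}\,P_{n+1}=\sum_T\frac{n!}{\prod_{j=1}^nh(j,T)}\prod_{j=1}^n\Bigl(\sum_{i\in\mathrm{desc}(j,T)}wt(i,j)\,u_i\Bigr),$$ where the sum is over the $C_n=\frac{1}{n+1}\binom{2n}{n}$ plane binary trees $T$ with $n$ nodes.
   Context: The permutohedron $P_{n+1}(x_1,\dots,x_{n+1})\subset\mathbb{R}^{n+1}$ is the convex hull of the points $(x_{w(1)},\dots,x_{w(n+1)})$, $w\in S_{n+1}$. $\mathrm{Vol}$ is the usual $n$-dimensional volume of the image under the projection $(t_1,\dots,t_{n+1})\mapsto(t_1,\dots,t_n)$. A plane binary tree is a rooted tree in which each node has at most one left child and at most one right child (an only child is specified to be left or right). The nodes of a plane binary tree $T$ with $n$ nodes are labeled by $1,\dots,n$ via the binary search labeling: the unique labeling such that for every node $v$ all labels in the left branch of $v$ are less than the label of $v$ and all labels in the right branch of $v$ are greater than the label of $v$. For a node $j$, $\mathrm{desc}(j,T)$ is the set of descendants of $j$ (including $j$ itself); it is an interval of integers $\mathrm{desc}(j,T)=[l_j,r_j]$. Let $h(j,T)=|\mathrm{desc}(j,T)|$. For nodes $i,j$ with $i\in\mathrm{desc}(j,T)$, define $$wt(i,j)=\min\left(\frac{i-l_j+1}{j-l_j+1},\frac{r_j-i+1}{r_j-j+1}\right).$$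 *)

theory Defs
  imports
    "HOL-Analysis.Analysis"
    "HOL-Library.Function_Algebras"
    "HOL-Library.Tree"
    "HOL-Combinatorics.Permutations"
begin

text \<open>
  The dimension is a natural number variable, so \<open>\<real>\<^sup>m\<close> is the linear subspace of
  \<^typ>\<open>nat \<Rightarrow> real\<close> formed by the functions that vanish outside \<open>{1..m}\<close>.
  The pointwise vector space structure makes the library notion
  \<^term>\<open>convex hull S\<close> available on it.
\<close>

instantiation "fun" :: (type, real_vector) real_vector
begin

definition scaleR_fun :: "real \<Rightarrow> ('a \<Rightarrow> 'b) \<Rightarrow> 'a \<Rightarrow> 'b" where
  "scaleR_fun c f = (\<lambda>x. c *\<^sub>R f x)"

instance
  by standard (auto simp: scaleR_fun_def fun_eq_iff scaleR_add_right scaleR_add_left)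

end

lemma scaleR_fun_apply [simp]: "(c *\<^sub>R f) x = c *\<^sub>R f x"
  by (simp add: scaleR_fun_def)

definition permutohedron :: "nat \<Rightarrow> (nat \<Rightarrow> real) \<Rightarrow> (nat \<Rightarrow> real) set" where
  "permutohedron m x =
     convex hull {(\<lambda>i. if i \<in> {1..m} then x (w i) else 0) | w. w permutes {1..m}}"

text \<open>
  \<open>vol_proj n P\<close> is the \<open>n\<close>-dimensional Lebesgue measure of the image of
  \<open>P \<subseteq> \<real>\<^sup>n\<^sup>+\<^sup>1\<close> under \<open>(t\<^sub>1, \<dots>, t\<^sub>n\<^sub>+\<^sub>1) \<mapsto> (t\<^sub>1, \<dots>, t\<^sub>n)\<close>. The product measure lives on the
  extensional functions on \<open>{1..n}\<close>, hence the use of \<^const>\<open>restrict\<close>.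
\<close>

definition vol_proj :: "nat \<Rightarrow> (nat \<Rightarrow> real) set \<Rightarrow> real" where
  "vol_proj n P = measure (\<Pi>\<^sub>M i\<in>{1..n}. lborel) ((\<lambda>t. restrict t {1..n}) ` P)"

text \<open>
  A plane binary tree is a \<^typ>\<open>unit tree\<close>: the nodes are the \<^const>\<open>Node\<close> constructors, and
  \<^const>\<open>Leaf\<close> stands for a missing left or right child.
\<close>

definition plane_binary_trees :: "nat \<Rightarrow> unit tree set" where
  "plane_binary_trees n = {T. size T = n}"

definition is_bs_labeling :: "unit tree \<Rightarrow> nat tree \<Rightarrow> bool" where
  "is_bs_labeling T L \<longleftrightarrow>
     map_tree (\<lambda>_. ()) L = T \<and> set_tree L = {1..size T} \<and> bst L"

definition bs_labeling :: "unit tree \<Rightarrow> nat tree" where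
  "bs_labeling T = (THE L. is_bs_labeling T L)"

definition desc :: "nat \<Rightarrow> unit tree \<Rightarrow> nat set" where
  "desc j T = {i. \<exists>l r. \<langle>l, j, r\<rangle> \<in> subtrees (bs_labeling T) \<and> i \<in> set_tree \<langle>l, j, r\<rangle>}"

definition h :: "nat \<Rightarrow> unit tree \<Rightarrow> nat" where
  "h j T = card (desc j T)"

definition wt :: "unit tree \<Rightarrow> nat \<Rightarrow> nat \<Rightarrow> real" where
  "wt T i j =
     (let l = Min (desc j T); r = Max (desc j T) in
      min ((real i - real l + 1) / (real j - real l + 1))
          ((real r - real i + 1) / (real r - real j + 1)))"


text \<open>The definite description in \<^const>\<open>bs_labeling\<close> and the sum over trees are well defined.\<close>

lemma ex_inorder_labeling:
  "\<exists>L. map_tree (\<lambda>_. ()) L = T \<and> inorder L = [a..<a + size T]"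
proof (induction T arbitrary: a)
  case Leaf
  show ?case by (intro exI[of _ Leaf]) simp
next
  case (Node l u r)
  obtain L where L: "map_tree (\<lambda>_. ()) L = l" "inorder L = [a..<a + size l]"
    using Node.IH(1) by blast
  obtain R where R: "map_tree (\<lambda>_. ()) R = r"
      "inorder R = [Suc (a + size l)..<Suc (a + size l) + size r]"
    using Node.IH(2) by blast
  have "[a..<a + size \<langle>l, u, r\<rangle>] = [a..<a + size l] @ [a + size l..<a + size l + Suc (size r)]"
    using upt_add_eq_append[of a "a + size l" "Suc (size r)"] by (simp add: add.assoc del: upt_Suc)
  also have "[a + size l..<a + size l + Suc (size r)] =
      (a + size l) # [Suc (a + size l)..<Suc (a + size l) + size r]"
    using upt_conv_Cons[of "a + size l" "a + size l + Suc (size r)"]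
    by (simp del: upt_Suc)
  finally show ?case
    using L R by (intro exI[of _ "\<langle>L, a + size l, R\<rangle>"]) (simp del: upt_Suc)
qed

lemma tree_eqI_map_inorder:
  "map_tree (\<lambda>_. ()) L = map_tree (\<lambda>_. ()) L' \<Longrightarrow> inorder L = inorder L' \<Longrightarrow> L = L'"
proof (induction L arbitrary: L')
  case Leaf
  then show ?case by (cases L') auto
next
  case (Node l a r)
  then obtain l' a' r' where L': "L' = \<langle>l', a', r'\<rangle>" by (cases L') auto
  with Node.prems have m: "map_tree (\<lambda>_. ()) l = map_tree (\<lambda>_. ()) l'"
      "map_tree (\<lambda>_. ()) r = map_tree (\<lambda>_. ()) r'" by auto
  then have "length (inorder l) = length (inorder l')"
    by (metis length_inorder size_map_tree)
  with Node.prems L' have "inorder l = inorder l'" "a = a'" "inorder r = inorder r'" by auto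
  with m Node.IH L' show ?case by blast
qed

lemma is_bs_labeling_iff_inorder:
  "is_bs_labeling T L \<longleftrightarrow>
     map_tree (\<lambda>_. ()) L = T \<and> inorder L = [1..<1 + size T]"
proof -
  have "set_tree L = {1..size T} \<and> bst L \<longleftrightarrow> inorder L = [1..<1 + size T]"
  proof
    assume *: "set_tree L = {1..size T} \<and> bst L"
    then have "set (inorder L) = set [1..<1 + size T]"
      by (simp add: atLeastLessThanSuc_atLeastAtMost del: upt_Suc)
    moreover have "sorted_wrt (<) (inorder L)"
      using * by (simp add: bst_iff_sorted_wrt_less)
    ultimately show "inorder L = [1..<1 + size T]"
      by (rule strict_sorted_equal[OF sorted_wrt_upt, rotated])
  next
    assume *: "inorder L = [1..<1 + size T]"
    have "set_tree L = {1..size T}"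
      unfolding set_inorder[symmetric] * by auto
    moreover have "bst L"
      unfolding bst_iff_sorted_wrt_less * by (rule sorted_wrt_upt)
    ultimately show "set_tree L = {1..size T} \<and> bst L" ..
  qed
  then show ?thesis unfolding is_bs_labeling_def by blast
qed

lemma ex1_bs_labeling: "\<exists>!L. is_bs_labeling T L"
  unfolding is_bs_labeling_iff_inorder
proof (rule ex_ex1I)
  show "\<exists>L. map_tree (\<lambda>_. ()) L = T \<and> inorder L = [1..<1 + size T]"
    by (rule ex_inorder_labeling)
qed (auto intro: tree_eqI_map_inorder simp del: upt_Suc)

lemma is_bs_labeling_bs_labeling: "is_bs_labeling T (bs_labeling T)"
  unfolding bs_labeling_def by (rule theI'[OF ex1_bs_labeling])

lemma finite_plane_binary_trees: "finite (plane_binary_trees n)"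
proof -
  have "finite {T :: unit tree. size T \<le> n}"
  proof (induction n)
    case (Suc n)
    let ?S = "{T :: unit tree. size T \<le> n}"
    have "{T :: unit tree. size T \<le> Suc n} \<subseteq>
        insert Leaf ((\<lambda>(l, r). \<langle>l, (), r\<rangle>) ` (?S \<times> ?S))"
    proof
      fix T :: "unit tree"
      assume "T \<in> {T. size T \<le> Suc n}"
      then show "T \<in> insert Leaf ((\<lambda>(l, r). \<langle>l, (), r\<rangle>) ` (?S \<times> ?S))"
        by (cases T) (auto simp: image_iff)
    qed
    with Suc show ?case by (meson finite_SigmaI finite_imageI finite_insert finite_subset)
  qed simp
  then show ?thesis
    by (rule finite_subset[rotated]) (auto simp: plane_binary_trees_def)
qed

end

(*
  The slice of a permutohedron by t_m = c with x_(j+1) <= c <= x_j is the permutohedron of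
  (x_1, ..., x_(j-1), x_j + x_(j+1) - c, x_(j+2), ..., x_m); this gives both Rado's description of the
  permutohedron by inequalities and, by Fubini, a recursion for the volume by a one-dimensional integral.
  Cutting the permutohedron into cones over its facets from the barycentre suggests the recursion
    (m - 1) g_m(x) = sum_k H_k(x) g_k(x_1, ..., x_k) g_(m-k)(x_(k+1), ..., x_m)
  for the volume divided by m!, where H_k(x) = x_1 + ... + x_k - (k/m) (x_1 + ... + x_m) is the height of
  the cones over the facets of type k. The polynomials g_m defined by it have the gradient that
  facet volumes predict, because the facets of facets contribute symmetrically, and then integration by
  parts on the slices shows that they satisfy the integral recursion. Expanding the cone recursion
  completely gives a sum over binary trees, the root being the type k of the facet.
*)
theory Submission
  imports Defs
begin

section \<open>Cone recursion and its gradient\<close>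

text \<open>There are \<open>m choose k\<close> facets of type \<open>k\<close>, each a product of a
  permutohedron of \<open>x_1, ..., x_k\<close> and one of \<open>x_(k+1), ..., x_m\<close>. Their
  volumes \<open>k! g_k\<close> and \<open>(m - k)! g_(m-k)\<close> turn the binomial coefficient
  into \<open>m!\<close>, so after division by \<open>m!\<close> no binomials remain;
  \<open>m - 1\<close> is the dimension in the volume formula for a cone. No cone or facet is ever
  constructed: the decomposition only motivates the definition of \<open>nvol\<close>, and geometry
  enters through the slices alone. The obstacle there is that the vector describing the slice has a
  different form on each segment from \<open>x_(j+1)\<close> to \<open>x_j\<close>, so the volume is
  a sum of integrals of different polynomials, and no single segment yields a closed formula. Only
  the sum over all segments does.\<close>

definition shift :: "nat \<Rightarrow> (nat \<Rightarrow> real) \<Rightarrow> nat \<Rightarrow> real" where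
  "shift k x = (\<lambda>i. x (i + k))"

definition psum :: "(nat \<Rightarrow> real) \<Rightarrow> nat \<Rightarrow> real" where
  "psum x k = (\<Sum>i = 1..k. x i)"

text \<open>\<open>psum x k\<close> bounds the sums of \<open>k\<close> coordinates; \<open>height\<close> measures that facet from the barycentre.\<close>

definition height :: "nat \<Rightarrow> (nat \<Rightarrow> real) \<Rightarrow> nat \<Rightarrow> real" where
  "height m x k = psum x k - real k / real m * psum x m"

text \<open>The volume of the permutohedron of \<open>x\<^sub>1, \<dots>, x\<^sub>m\<close> divided by \<open>m!\<close>; the value at \<open>m = 0\<close> is irrelevant.\<close>

function nvol :: "nat \<Rightarrow> (nat \<Rightarrow> real) \<Rightarrow> real" where
  "nvol m x = (if m \<le> 1 then 1 else
     (\<Sum>k\<in>{1..<m}. height m x k * nvol k x * nvol (m - k) (shift k x)) / (real m - 1))"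
  by pat_completeness auto
termination by (relation "Wellfounded.measure fst") auto

declare nvol.simps [simp del]

lemma nvol_1 [simp]: "nvol (Suc 0) x = 1"
  by (simp add: nvol.simps)

lemma nvol_rec:
  assumes "m \<ge> 1"
  shows "(real m - 1) * nvol m x =
    (\<Sum>k\<in>{1..<m}. height m x k * nvol k x * nvol (m - k) (shift k x))"
  using assms by (cases "m = 1") (simp_all add: nvol.simps[of m])

lemma shift_apply: "shift k x i = x (i + k)"
  by (simp add: shift_def)

lemma shift_shift [simp]: "shift j (shift k x) = shift (j + k) x"
  by (simp add: shift_def fun_eq_iff add.assoc)

lemma psum_0 [simp]: "psum x 0 = 0"
  by (simp add: psum_def)

lemma psum_Suc: "psum x (Suc k) = psum x k + x (Suc k)"
  by (simp add: psum_def)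

lemma psum_add: "psum x (j + k) = psum x k + psum (shift k x) j"
  by (induction j) (simp_all add: psum_Suc shift_apply)

lemma psum_shift: "k \<le> j \<Longrightarrow> psum (shift k x) (j - k) = psum x j - psum x k"
  using psum_add[of x "j - k" k] by simp

lemma psum_cong: "(\<And>i. i \<in> {1..k} \<Longrightarrow> x i = y i) \<Longrightarrow> psum x k = psum y k"
  unfolding psum_def by (rule sum.cong) auto

lemma nvol_cong:
  "(\<And>i. i \<in> {1..m} \<Longrightarrow> x i = y i) \<Longrightarrow> nvol m x = nvol m y"
proof (induction m arbitrary: x y rule: less_induct)
  case (less m)
  show ?case
  proof (cases "m \<le> 1")
    case False
    have "height m x k * nvol k x * nvol (m - k) (shift k x)
        = height m y k * nvol k y * nvol (m - k) (shift k y)" if "k \<in> {1..<m}" for k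
    proof -
      have "nvol k x = nvol k y" "nvol (m - k) (shift k x) = nvol (m - k) (shift k y)"
        using that less.prems by (auto intro!: less.IH simp: shift_apply)
      moreover have "psum x k = psum y k" "psum x m = psum y m"
        using that less.prems by (auto intro!: psum_cong)
      ultimately show ?thesis by (simp add: height_def)
    qed
    then show ?thesis using False by (simp add: nvol.simps[of m])
  qed (simp add: nvol.simps[of m])
qed

text \<open>\<open>height m x\<close> is \<open>psum x\<close> minus the chord joining its values at
  0 and \<open>m\<close>. Recentring on the block \<open>1..k\<close> therefore subtracts one more
  chord, from 0 to \<open>k\<close>; in \<open>height_shift\<close> it is the chord from
  \<open>k\<close> to \<open>m\<close>, where \<open>height m x\<close> vanishes.\<close>

lemma height_restrict:
  assumes "0 < k" "0 < m"
  shows "height k x j = height m x j - real j / real k * height m x k"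
  using assms by (simp add: height_def field_simps)

lemma height_shift:
  assumes "k < j" "j < m"
  shows "height (m - k) (shift k x) (j - k) =
    height m x j - real (m - j) / real (m - k) * height m x k"
  using assms by (simp add: height_def psum_shift of_nat_diff field_simps)

lemma height_add_scale:
  "height m (\<lambda>i. x i + t * e i) k = height m x k + t * height m e k"
  by (simp add: height_def psum_def sum.distrib sum_distrib_left[symmetric] algebra_simps)

lemma sum_triangle_swap:
  fixes f :: "nat \<Rightarrow> nat \<Rightarrow> real"
  shows "(\<Sum>k\<in>{1..<m}. \<Sum>j\<in>{k<..<m}. f k j) = (\<Sum>k\<in>{1..<m}. \<Sum>j\<in>{1..<k}. f j k)"
proof -
  have "(\<Sum>k\<in>{1..<m}. \<Sum>j\<in>{k<..<m}. f k j) = (\<Sum>k\<in>{1..<m}. \<Sum>j\<in>{j\<in>{1..<m}. k < j}. f k j)"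
    by (intro sum.cong) auto
  also have "\<dots> = (\<Sum>j\<in>{1..<m}. \<Sum>k\<in>{k\<in>{1..<m}. k < j}. f k j)"
    by (rule sum.swap_restrict) auto
  also have "\<dots> = (\<Sum>k\<in>{1..<m}. \<Sum>j\<in>{1..<k}. f j k)"
    by (intro sum.cong) auto
  finally show ?thesis .
qed

text \<open>\<open>triple\<close> is the contribution of a codimension two face, \<open>dprod\<close> the derivative along \<open>e\<close> of the
  contribution of a facet.\<close>

definition triple :: "nat \<Rightarrow> (nat \<Rightarrow> real) \<Rightarrow> nat \<Rightarrow> nat \<Rightarrow> real" where
  "triple m x j k = nvol j x * nvol (k - j) (shift j x) * nvol (m - k) (shift k x)"

definition dprod :: "nat \<Rightarrow> (nat \<Rightarrow> real) \<Rightarrow> (nat \<Rightarrow> real) \<Rightarrow> nat \<Rightarrow> real" where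
  "dprod m x e k =
     (\<Sum>j\<in>{1..<k}. height k e j * nvol j x * nvol (k - j) (shift j x)) * nvol (m - k) (shift k x) +
     nvol k x * (\<Sum>j\<in>{1..<m - k}. height (m - k) (shift k e) j *
        nvol j (shift k x) * nvol (m - k - j) (shift j (shift k x)))"

text \<open>Euler's identity for a product of degree \<open>(k - 1) + (m - k - 1)\<close>: for
  \<open>e = x\<close> the two sums in \<open>dprod\<close> are those that \<open>nvol_rec\<close>
  evaluates.\<close>

lemma dprod_self:
  assumes "k \<in> {1..<m}"
  shows "dprod m x x k = (real m - 2) * (nvol k x * nvol (m - k) (shift k x))"
proof -
  have r: "(\<Sum>j\<in>{1..<k}. height k x j * nvol j x * nvol (k - j) (shift j x)) =
      (real k - 1) * nvol k x"
    "(\<Sum>j\<in>{1..<m - k}. height (m - k) (shift k x) j * nvol j (shift k x) *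
       nvol (m - k - j) (shift j (shift k x))) = (real (m - k) - 1) * nvol (m - k) (shift k x)"
    using assms by (simp_all only: nvol_rec atLeastLessThan_iff zero_less_diff Suc_le_eq One_nat_def)
  have "dprod m x x k = (real k - 1) * nvol k x * nvol (m - k) (shift k x) +
      nvol k x * ((real (m - k) - 1) * nvol (m - k) (shift k x))"
    unfolding dprod_def r ..
  then show ?thesis using assms by (simp add: of_nat_diff algebra_simps)
qed

text \<open>Writing the heights of both factors through \<open>height m e\<close> puts all facets on
  the same footing, which the symmetry argument needs. Indices \<open>j < k\<close> split the first
  factor, \<open>j > k\<close> the second.\<close>

lemma dprod_eq:
  assumes "k \<in> {1..<m}"
  shows "dprod m x e k =
    (\<Sum>j\<in>{1..<k}. (height m e j - real j / real k * height m e k) * triple m x j k) +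
    (\<Sum>j\<in>{k<..<m}. (height m e j - real (m - j) / real (m - k) * height m e k) * triple m x k j)"
proof -
  have "(\<Sum>j\<in>{1..<m - k}. height (m - k) (shift k e) j *
        nvol j (shift k x) * nvol (m - k - j) (shift j (shift k x))) =
      (\<Sum>j\<in>{k<..<m}. height (m - k) (shift k e) (j - k) *
        nvol (j - k) (shift k x) * nvol (m - j) (shift j x))"
    by (rule sum.reindex_bij_witness[of _ "\<lambda>j. j - k" "\<lambda>j. j + k"]) (auto simp: algebra_simps)
  also have "\<dots> = (\<Sum>j\<in>{k<..<m}. (height m e j - real (m - j) / real (m - k) * height m e k) *
        nvol (j - k) (shift k x) * nvol (m - j) (shift j x))"
    by (intro sum.cong) (simp_all only: height_shift greaterThanLessThan_iff)
  finally have upper: "(\<Sum>j\<in>{1..<m - k}. height (m - k) (shift k e) j *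
        nvol j (shift k x) * nvol (m - k - j) (shift j (shift k x))) = \<dots>" .
  have lower: "(\<Sum>j\<in>{1..<k}. height k e j * nvol j x * nvol (k - j) (shift j x)) =
      (\<Sum>j\<in>{1..<k}. (height m e j - real j / real k * height m e k) *
        nvol j x * nvol (k - j) (shift j x))"
    using assms by (intro sum.cong refl, subst height_restrict[of k m]) auto
  show ?thesis
    unfolding dprod_def triple_def lower upper sum_distrib_left sum_distrib_right
    by (simp only: mult_ac)
qed

text \<open>The left side is a bilinear form in the heights of \<open>e\<close> and \<open>e'\<close> with symmetric coefficients.\<close>

lemma sum_height_dprod:
  "(\<Sum>k\<in>{1..<m}. height m e k * dprod m x e' k) = (\<Sum>k\<in>{1..<m}. height m e' k * dprod m x e k)"
proof -
  have *: "(\<Sum>k\<in>{1..<m}. height m a k * dprod m x b k) =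
    (\<Sum>k\<in>{1..<m}. \<Sum>j\<in>{1..<k}. triple m x j k *
      (height m a k * height m b j + height m a j * height m b k
       - real j / real k * (height m a k * height m b k)
       - real (m - k) / real (m - j) * (height m a j * height m b j)))" (is "?l = ?r") for a b
  proof -
    have "?l = (\<Sum>k\<in>{1..<m}.
        (\<Sum>j\<in>{1..<k}. height m a k * ((height m b j - real j / real k * height m b k) * triple m x j k)) +
        (\<Sum>j\<in>{k<..<m}. height m a k * ((height m b j - real (m - j) / real (m - k) * height m b k) * triple m x k j)))"
      by (intro sum.cong) (simp_all add: dprod_eq distrib_left sum_distrib_left)
    \<comment> \<open>The face given by \<open>j < k\<close> arises twice, from facet
      \<open>k\<close> split at \<open>j\<close> and from facet \<open>j\<close> split at
      \<open>k\<close>. Exchanging the second double sum collects both under one pair, and the two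
      mixed terms change places when \<open>a\<close> and \<open>b\<close> do.\<close>
    also have "\<dots> = ?r"
      unfolding sum.distrib sum_triangle_swap unfolding sum.distrib[symmetric]
      by (intro sum.cong refl) (simp only: ring_distribs mult_ac, simp)
    finally show ?thesis .
  qed
  show ?thesis unfolding * by (simp add: mult_ac add_ac)
qed

text \<open>The product rule on the recursion gives the claimed sum once from the heights. In the
  remaining part \<open>sum_height_dprod\<close> exchanges \<open>e\<close> with the point itself,
  and \<open>dprod_self\<close> then gives the same sum \<open>m - 2\<close> more times. The total
  factor \<open>m - 1\<close> cancels against the one in \<open>nvol_rec\<close>.\<close>

lemma nvol_has_derivative_line:
  assumes "m \<ge> 1"
  shows "((\<lambda>t. nvol m (\<lambda>i. x i + t * e i)) has_real_derivative
    (\<Sum>k\<in>{1..<m}. height m e k * nvol k (\<lambda>i. x i + t * e i) *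
       nvol (m - k) (shift k (\<lambda>i. x i + t * e i)))) (at t)"
  using assms
proof (induction m arbitrary: x e rule: less_induct)
  case (less m)
  let ?x = "\<lambda>t i. x i + t * e i"
  show ?case
  proof (cases "m = 1")
    case False
    have sh: "shift k (?x t) = (\<lambda>i. shift k x i + t * shift k e i)" for k t
      by (simp add: shift_def)
    have d: "((\<lambda>t. nvol k (?x t) * nvol (m - k) (shift k (?x t))) has_real_derivative
        dprod m (?x t) e k) (at t)" if "k \<in> {1..<m}" for k
    proof -
      have d1: "((\<lambda>t. nvol k (?x t)) has_real_derivative
          (\<Sum>j\<in>{1..<k}. height k e j * nvol j (?x t) * nvol (k - j) (shift j (?x t)))) (at t)"
        using that by (intro less.IH) auto
      have d2: "((\<lambda>t. nvol (m - k) (shift k (?x t))) has_real_derivative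
          (\<Sum>j\<in>{1..<m - k}. height (m - k) (shift k e) j * nvol j (shift k (?x t)) *
             nvol (m - k - j) (shift j (shift k (?x t))))) (at t)"
        unfolding sh using that by (intro less.IH) auto
      show ?thesis
        unfolding dprod_def by (rule derivative_eq_intros d1 d2 refl)+ (simp add: mult_ac)
    qed
    have hd: "((\<lambda>t. height m (?x t) k) has_real_derivative height m e k) (at t)" for k
      unfolding height_add_scale by (auto intro!: derivative_eq_intros)
    define A where "A t k = nvol k (?x t) * nvol (m - k) (shift k (?x t))" for t k
    have dA: "((\<lambda>t. A t k) has_real_derivative dprod m (?x t) e k) (at t)" if "k \<in> {1..<m}" for k
      unfolding A_def using d[OF that] .
    have "((\<lambda>t. \<Sum>k\<in>{1..<m}. height m (?x t) k * A t k) has_real_derivative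
        (\<Sum>k\<in>{1..<m}. height m e k * A t k + dprod m (?x t) e k * height m (?x t) k)) (at t)"
      by (intro DERIV_sum DERIV_mult hd dA)
    moreover have "(\<Sum>k\<in>{1..<m}. height m e k * A t k + dprod m (?x t) e k * height m (?x t) k) =
        (real m - 1) * (\<Sum>k\<in>{1..<m}. height m e k * A t k)"
    proof -
      have "(\<Sum>k\<in>{1..<m}. height m (?x t) k * dprod m (?x t) e k) =
          (\<Sum>k\<in>{1..<m}. height m e k * dprod m (?x t) (?x t) k)"
        by (rule sum_height_dprod)
      also have "\<dots> = (real m - 2) * (\<Sum>k\<in>{1..<m}. height m e k * A t k)"
        by (simp add: dprod_self A_def sum_distrib_left mult_ac)
      finally show ?thesis by (simp add: sum.distrib mult_ac algebra_simps)
    qed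
    moreover have "(\<lambda>t. \<Sum>k\<in>{1..<m}. height m (?x t) k * A t k) = (\<lambda>t. (real m - 1) * nvol m (?x t))"
      using less.prems by (simp add: fun_eq_iff nvol_rec A_def mult.assoc)
    ultimately have "((\<lambda>t. (real m - 1) * nvol m (?x t)) has_real_derivative
        (real m - 1) * (\<Sum>k\<in>{1..<m}. height m e k * A t k)) (at t)" by simp
    from DERIV_cdivide[OF this, of "real m - 1"] show ?thesis
      using False less.prems unfolding A_def mult.assoc by simp
  qed simp
qed

section \<open>Integration over slices\<close>

definition slice :: "nat \<Rightarrow> real \<Rightarrow> (nat \<Rightarrow> real) \<Rightarrow> nat \<Rightarrow> real" where
  "slice j c x = (\<lambda>i. if i < j then x i else if i = j then x j + x (Suc j) - c else x (Suc i))"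

text \<open>The slice at an end of a segment. Segments \<open>j\<close> and \<open>j + 1\<close>
  share the vector \<open>skip (Suc j) x\<close>, so their boundary terms cancel.\<close>

definition skip :: "nat \<Rightarrow> (nat \<Rightarrow> real) \<Rightarrow> nat \<Rightarrow> real" where
  "skip j x = (\<lambda>i. if i < j then x i else x (Suc i))"

definition decr :: "nat \<Rightarrow> (nat \<Rightarrow> real) \<Rightarrow> bool" where
  "decr m x \<longleftrightarrow> (\<forall>i\<in>{1..<m}. x (Suc i) \<le> x i)"

lemma slice_upper: "slice j (x j) x = skip j x"
  by (auto simp: slice_def skip_def)

lemma slice_lower: "slice j (x (Suc j)) x = skip (Suc j) x"
  by (auto simp: slice_def skip_def fun_eq_iff less_Suc_eq)

lemma nvol_slice_less: "k < j \<Longrightarrow> nvol k (slice j c x) = nvol k x"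
  by (rule nvol_cong) (simp add: slice_def)

lemma shift_slice_less: "k < j \<Longrightarrow> shift k (slice j c x) = slice (j - k) c (shift k x)"
  by (auto simp: slice_def shift_def fun_eq_iff less_diff_conv Suc_diff_le)

lemma nvol_shift_slice_ge:
  "j \<le> k \<Longrightarrow> nvol p (shift k (slice j c x)) = nvol p (shift (Suc k) x)"
  by (rule nvol_cong) (auto simp: slice_def shift_def)

lemma psum_slice:
  assumes "1 \<le> j"
  shows "psum (slice j c x) k = (if k < j then psum x k else psum x (Suc k) - c)"
proof (induction k)
  case (Suc k)
  then show ?case using assms
    by (cases "Suc k = j") (auto simp: psum_Suc slice_def)
qed (use assms in simp)

lemma slice_line: "slice j c x = (\<lambda>i. slice j 0 x i + c * (if i = j then - 1 else 0))"
  by (auto simp: slice_def)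

lemma psum_unit:
  assumes "1 \<le> j"
  shows "psum (\<lambda>i. if i = j then - 1 else 0) k = (if j \<le> k then - 1 else 0)"
  using assms by (auto simp: psum_def)

text \<open>Only entry \<open>j\<close> moves with \<open>c\<close>, with slope \<open>- 1\<close>;
  the bracket is the height of this direction.\<close>

lemma nvol_slice_has_derivative:
  assumes "1 \<le> j" "j \<le> p"
  shows "((\<lambda>c. nvol p (slice j c x)) has_real_derivative
    (\<Sum>k\<in>{1..<p}. (real k / real p - (if j \<le> k then 1 else 0)) * nvol k (slice j c x) *
       nvol (p - k) (shift k (slice j c x)))) (at c)"
proof -
  let ?e = "\<lambda>i. if i = j then - 1 else 0 :: real"
  have "p \<ge> 1" using assms by simp
  from nvol_has_derivative_line[OF this, of "slice j 0 x" ?e c]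
  have "((\<lambda>c. nvol p (slice j c x)) has_real_derivative
    (\<Sum>k\<in>{1..<p}. height p ?e k * nvol k (slice j c x) *
       nvol (p - k) (shift k (slice j c x)))) (at c)"
    unfolding slice_line[symmetric] .
  moreover have "height p ?e k = real k / real p - (if j \<le> k then 1 else 0)" for k
    using assms by (simp add: height_def psum_unit)
  ultimately show ?thesis by simp
qed

lemma continuous_on_nvol_slice:
  assumes "1 \<le> j" "j \<le> p"
  shows "continuous_on S (\<lambda>c. nvol p (slice j c x))"
  using nvol_slice_has_derivative[OF assms]
  by (intro continuous_at_imp_continuous_on ballI) (blast intro: DERIV_isCont)

text \<open>Divergence theorem for the vector field \<open>t \<mapsto> t - (a, \<dots>, a)\<close>, one slice at a time.\<close>

lemma slice_divergence:
  assumes j: "1 \<le> j" "j \<le> p" and a: "a = psum x (Suc p) / real (Suc p)"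
  shows "((\<lambda>c. (c - a) * nvol p (slice j c x)) has_real_derivative
    real p * nvol p (slice j c x) -
    (\<Sum>k\<in>{1..<j}. height (Suc p) x k * nvol k x * nvol (p - k) (slice (j - k) c (shift k x))) -
    (\<Sum>k\<in>{j<..p}. height (Suc p) x k * nvol (Suc p - k) (shift k x) * nvol (k - 1) (slice j c x))) (at c)"
proof -
  define y where "y = slice j c x"
  define A where "A k = nvol k y * nvol (p - k) (shift k y)" for k
  have p: "p \<ge> 1" using j by simp
  have "(real p - 1) * nvol p y = (\<Sum>k\<in>{1..<p}. height p y k * A k)"
    using nvol_rec[OF p, of y] by (simp add: A_def mult.assoc)
  \<comment> \<open>One copy of \<open>nvol p y\<close> is \<open>p\<close> copies minus the
    \<open>p - 1\<close> copies that \<open>nvol_rec\<close> expands, so that recursion and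
    derivative combine over the same products \<open>A k\<close>.\<close>
  then have "nvol p y + (c - a) * (\<Sum>k\<in>{1..<p}. (real k / real p - (if j \<le> k then 1 else 0)) * A k) =
     real p * nvol p y -
     (\<Sum>k\<in>{1..<p}. (height p y k - (c - a) * (real k / real p - (if j \<le> k then 1 else 0))) * A k)"
    unfolding left_diff_distrib sum_subtractf mult.assoc sum_distrib_left[symmetric] by simp
  \<comment> \<open>A facet of type \<open>k\<close> of the slice is cut from a facet of the whole:
    of type \<open>k\<close> if \<open>k < j\<close>, otherwise of type \<open>k + 1\<close>, whose
    index set contains the sliced coordinate. The correction moves the reference point of the
    heights from the barycentre of the slice to \<open>(a, ..., a)\<close>.\<close>
  also have "(\<Sum>k\<in>{1..<p}. (height p y k - (c - a) * (real k / real p - (if j \<le> k then 1 else 0))) * A k)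
      = (\<Sum>k\<in>{1..<p}. height (Suc p) x (if j \<le> k then Suc k else k) * A k)"
  proof (intro sum.cong refl)
    fix k
    have S: "psum x (Suc p) = a * (real p + 1)"
      by (simp add: a field_simps)
    have x: "height (Suc p) x l = psum x l - real l * a" for l
      by (simp add: height_def S add.commute)
    have y: "height p y k = psum y k - real k / real p * (a * (real p + 1) - c)"
      using j by (simp add: height_def y_def psum_slice S)
    have "height p y k - (c - a) * (real k / real p) = psum y k - real k * a"
      using p by (simp add: y field_simps)
    then have "height p y k - (c - a) * (real k / real p - (if j \<le> k then 1 else 0)) =
        height (Suc p) x (if j \<le> k then Suc k else k)"
      unfolding x y_def using j by (simp add: psum_slice algebra_simps)
    then show "(height p y k - (c - a) * (real k / real p - (if j \<le> k then 1 else 0))) * A k =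
        height (Suc p) x (if j \<le> k then Suc k else k) * A k"
      by simp
  qed
  also have "\<dots> = (\<Sum>k\<in>{1..<j}. height (Suc p) x (if j \<le> k then Suc k else k) * A k) +
      (\<Sum>k\<in>{j..<p}. height (Suc p) x (if j \<le> k then Suc k else k) * A k)"
    using j by (intro sum.atLeastLessThan_concat[symmetric]) auto
  also have "(\<Sum>k\<in>{1..<j}. height (Suc p) x (if j \<le> k then Suc k else k) * A k) =
      (\<Sum>k\<in>{1..<j}. height (Suc p) x k * nvol k x * nvol (p - k) (slice (j - k) c (shift k x)))"
    by (intro sum.cong) (simp_all add: A_def y_def nvol_slice_less shift_slice_less)
  also have "(\<Sum>k\<in>{j..<p}. height (Suc p) x (if j \<le> k then Suc k else k) * A k) =
      (\<Sum>k\<in>{j<..p}. height (Suc p) x k * nvol (Suc p - k) (shift k x) * nvol (k - 1) (slice j c x))"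
    by (rule sum.reindex_bij_witness[of _ "\<lambda>k. k - 1" Suc])
      (auto simp: A_def y_def nvol_shift_slice_ge)
  finally have eq: "nvol p y + (c - a) * (\<Sum>k\<in>{1..<p}. (real k / real p - (if j \<le> k then 1 else 0)) * A k) = real p * nvol p y -
    (\<Sum>k\<in>{1..<j}. height (Suc p) x k * nvol k x * nvol (p - k) (slice (j - k) c (shift k x))) -
    (\<Sum>k\<in>{j<..p}. height (Suc p) x k * nvol (Suc p - k) (shift k x) * nvol (k - 1) (slice j c x))"
    by simp
  have "((\<lambda>c. (c - a) * nvol p (slice j c x)) has_real_derivative
     1 * nvol p y + (\<Sum>k\<in>{1..<p}. (real k / real p - (if j \<le> k then 1 else 0)) * A k) * (c - a)) (at c)"
    unfolding y_def A_def mult.assoc[symmetric]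
    by (intro DERIV_mult nvol_slice_has_derivative j) (auto intro!: derivative_eq_intros)
  also have "1 * nvol p y + (\<Sum>k\<in>{1..<p}. (real k / real p - (if j \<le> k then 1 else 0)) * A k) * (c - a) = real p * nvol p y -
    (\<Sum>k\<in>{1..<j}. height (Suc p) x k * nvol k x * nvol (p - k) (slice (j - k) c (shift k x))) -
    (\<Sum>k\<in>{j<..p}. height (Suc p) x k * nvol (Suc p - k) (shift k x) * nvol (k - 1) (slice j c x))"
    using eq by (simp only: mult_1 mult.commute)
  finally show ?thesis unfolding y_def .
qed

definition slice_int :: "nat \<Rightarrow> nat \<Rightarrow> (nat \<Rightarrow> real) \<Rightarrow> real" where
  "slice_int p j x = integral {x (Suc j)..x j} (\<lambda>c. nvol p (slice j c x))"

lemma nvol_slice_has_integral: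
  assumes "1 \<le> j" "j \<le> p"
  shows "((\<lambda>c. nvol p (slice j c x)) has_integral slice_int p j x) {x (Suc j)..x j}"
  unfolding slice_int_def
  by (intro integrable_integral integrable_continuous_real continuous_on_nvol_slice assms)

text \<open>\<open>slice_divergence\<close> integrated over the segment. In each facet term only one
  of the two factors varies with \<open>c\<close>, and its integral is a slice integral of lower
  dimension.\<close>

lemma slice_int_rec:
  assumes j: "1 \<le> j" "j \<le> p" and a: "a = psum x (Suc p) / real (Suc p)" and le: "x (Suc j) \<le> x j"
  shows "real p * slice_int p j x =
    (\<Sum>k\<in>{1..<j}. height (Suc p) x k * nvol k x * slice_int (p - k) (j - k) (shift k x)) +
    (\<Sum>k\<in>{j<..p}. height (Suc p) x k * nvol (Suc p - k) (shift k x) * slice_int (k - 1) j x) +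
    ((x j - a) * nvol p (skip j x) - (x (Suc j) - a) * nvol p (skip (Suc j) x))"
proof -
  let ?I = "{x (Suc j)..x j}"
  have "((\<lambda>c. real p * nvol p (slice j c x) -
    (\<Sum>k\<in>{1..<j}. height (Suc p) x k * nvol k x * nvol (p - k) (slice (j - k) c (shift k x))) -
    (\<Sum>k\<in>{j<..p}. height (Suc p) x k * nvol (Suc p - k) (shift k x) * nvol (k - 1) (slice j c x)))
    has_integral (x j - a) * nvol p (slice j (x j) x) - (x (Suc j) - a) * nvol p (slice j (x (Suc j)) x)) ?I"
    using slice_divergence[OF j a] le
    by (intro fundamental_theorem_of_calculus)
      (auto simp flip: has_real_derivative_iff_has_vector_derivative intro: has_field_derivative_at_within)
  moreover have "((\<lambda>c. real p * nvol p (slice j c x) -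
    (\<Sum>k\<in>{1..<j}. height (Suc p) x k * nvol k x * nvol (p - k) (slice (j - k) c (shift k x))) -
    (\<Sum>k\<in>{j<..p}. height (Suc p) x k * nvol (Suc p - k) (shift k x) * nvol (k - 1) (slice j c x)))
    has_integral real p * slice_int p j x -
    (\<Sum>k\<in>{1..<j}. height (Suc p) x k * nvol k x * slice_int (p - k) (j - k) (shift k x)) -
    (\<Sum>k\<in>{j<..p}. height (Suc p) x k * nvol (Suc p - k) (shift k x) * slice_int (k - 1) j x)) ?I"
  proof (intro has_integral_diff has_integral_sum has_integral_mult_right nvol_slice_has_integral finite_atLeastLessThan finite_greaterThanAtMost j)
    fix k assume k: "k \<in> {1..<j}"
    then have "((\<lambda>c. nvol (p - k) (slice (j - k) c (shift k x))) has_integral slice_int (p - k) (j - k) (shift k x))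
        {shift k x (Suc (j - k))..shift k x (j - k)}"
      using j by (intro nvol_slice_has_integral) auto
    then show "((\<lambda>c. nvol (p - k) (slice (j - k) c (shift k x))) has_integral slice_int (p - k) (j - k) (shift k x)) ?I"
      using k by (simp add: shift_apply)
  qed (use j in auto)
  ultimately show ?thesis
    by (simp add: slice_upper slice_lower) (drule (1) has_integral_unique, simp)
qed

text \<open>Facet \<open>k\<close> receives \<open>k\<close> copies of \<open>H k * A k\<close> by
  induction from slices through its first factor and \<open>m - k\<close> from slices through its
  second, hence \<open>m\<close> in total. A factor of dimension 0 has no segments, whence the
  correction at \<open>m = 1\<close>; it leaves facets 1 and \<open>m - 1\<close> one copy short.
  These copies are the boundary terms that survive telescoping, since the slices at
  \<open>c = x 1\<close> and \<open>c = x m\<close> are themselves such facets.\<close>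

lemma sum_slice_int:
  assumes "m \<ge> 1" "decr m x"
  shows "(\<Sum>j\<in>{1..<m}. slice_int (m - 1) j x) = real m * nvol m x - (if m = 1 then 1 else 0)"
  using assms
proof (induction m arbitrary: x rule: less_induct)
  case (less m)
  show ?case
  proof (cases "m = 1")
    case False
    then obtain p where m: "m = Suc p" and p: "p \<ge> 1"
      using less.prems(1) by (cases m) auto
    define a where "a = psum x (Suc p) / real (Suc p)"
    define B where "B j = (x j - a) * nvol p (skip j x)" for j
    define H where "H = height m x"
    define A where "A k = nvol k x * nvol (m - k) (shift k x)" for k
    have "real p * (\<Sum>j\<in>{1..<m}. slice_int p j x) = (\<Sum>j\<in>{1..<m}.
        (\<Sum>k\<in>{1..<j}. H k * nvol k x * slice_int (p - k) (j - k) (shift k x)) +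
        (\<Sum>k\<in>{j<..<m}. H k * nvol (m - k) (shift k x) * slice_int (k - 1) j x) +
        (B j - B (Suc j)))"
      unfolding sum_distrib_left
    proof (intro sum.cong refl)
      fix j assume "j \<in> {1..<m}"
      then show "real p * slice_int p j x =
        (\<Sum>k\<in>{1..<j}. H k * nvol k x * slice_int (p - k) (j - k) (shift k x)) +
        (\<Sum>k\<in>{j<..<m}. H k * nvol (m - k) (shift k x) * slice_int (k - 1) j x) +
        (B j - B (Suc j))"
        using slice_int_rec[OF _ _ a_def, of j] less.prems(2) m
        by (simp add: H_def B_def decr_def less_Suc_eq_le greaterThanLessThan_upt greaterThanAtMost_upt)
    qed
    also have "\<dots> = (\<Sum>j\<in>{1..<m}. \<Sum>k\<in>{1..<j}. H k * nvol k x * slice_int (p - k) (j - k) (shift k x)) +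
        (\<Sum>j\<in>{1..<m}. \<Sum>k\<in>{j<..<m}. H k * nvol (m - k) (shift k x) * slice_int (k - 1) j x) +
        (\<Sum>j\<in>{1..<m}. B j - B (Suc j))"
      by (simp only: sum.distrib)
    also have "(\<Sum>j\<in>{1..<m}. B j - B (Suc j)) = B 1 - B m"
      using sum_Suc_diff'[of 1 m "\<lambda>j. - B j"] less.prems(1) by simp
    also have "B 1 = H 1 * A 1"
    proof -
      have "nvol p (skip 1 x) = nvol p (shift 1 x)"
        by (rule nvol_cong) (auto simp: skip_def shift_def)
      moreover have "H 1 = x 1 - a"
        by (simp add: H_def height_def m a_def psum_Suc)
      ultimately show ?thesis by (simp add: B_def A_def m)
    qed
    also have "B m = - H p * A p"
    proof -
      have "nvol p (skip m x) = nvol p x"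
        by (rule nvol_cong) (auto simp: skip_def m)
      moreover have "H p = a - x m"
        by (simp add: H_def height_def m a_def psum_Suc field_simps)
      ultimately show ?thesis by (simp add: B_def A_def m)
    qed
    also have "(\<Sum>j\<in>{1..<m}. \<Sum>k\<in>{1..<j}. H k * nvol k x * slice_int (p - k) (j - k) (shift k x)) =
        (\<Sum>k\<in>{1..<m}. \<Sum>j\<in>{k<..<m}. H k * nvol k x * slice_int (p - k) (j - k) (shift k x))"
      by (rule sum_triangle_swap[symmetric])
    also have "\<dots> = (\<Sum>k\<in>{1..<m}. H k * nvol k x *
        (real (m - k) * nvol (m - k) (shift k x) - (if m - k = 1 then 1 else 0)))"
    proof (intro sum.cong refl)
      fix k assume k: "k \<in> {1..<m}"
      have "(\<Sum>j\<in>{k<..<m}. slice_int (p - k) (j - k) (shift k x)) =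
          (\<Sum>j\<in>{1..<m - k}. slice_int (m - k - 1) j (shift k x))"
        by (rule sum.reindex_bij_witness[of _ "\<lambda>j. j + k" "\<lambda>j. j - k"]) (auto simp: m)
      also have "\<dots> = real (m - k) * nvol (m - k) (shift k x) - (if m - k = 1 then 1 else 0)"
        using k less.prems by (intro less.IH) (auto simp: decr_def shift_def)
      finally show "(\<Sum>j\<in>{k<..<m}. H k * nvol k x * slice_int (p - k) (j - k) (shift k x)) =
        H k * nvol k x * (real (m - k) * nvol (m - k) (shift k x) - (if m - k = 1 then 1 else 0))"
        by (simp only: sum_distrib_left[symmetric])
    qed
    also have "(\<Sum>j\<in>{1..<m}. \<Sum>k\<in>{j<..<m}. H k * nvol (m - k) (shift k x) * slice_int (k - 1) j x) =
       (\<Sum>k\<in>{1..<m}. \<Sum>j\<in>{1..<k}. H k * nvol (m - k) (shift k x) * slice_int (k - 1) j x)"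
      by (rule sum_triangle_swap)
    also have "\<dots> = (\<Sum>k\<in>{1..<m}. H k * nvol (m - k) (shift k x) *
        (real k * nvol k x - (if k = 1 then 1 else 0)))"
    proof (intro sum.cong refl)
      fix k assume k: "k \<in> {1..<m}"
      have "(\<Sum>j\<in>{1..<k}. slice_int (k - 1) j x) = real k * nvol k x - (if k = 1 then 1 else 0)"
        using k less.prems by (intro less.IH) (auto simp: decr_def)
      then show "(\<Sum>j\<in>{1..<k}. H k * nvol (m - k) (shift k x) * slice_int (k - 1) j x) =
        H k * nvol (m - k) (shift k x) * (real k * nvol k x - (if k = 1 then 1 else 0))"
        by (simp only: sum_distrib_left[symmetric])
    qed
    also have "(\<Sum>k\<in>{1..<m}. H k * nvol k x *
          (real (m - k) * nvol (m - k) (shift k x) - (if m - k = 1 then 1 else 0))) +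
        (\<Sum>k\<in>{1..<m}. H k * nvol (m - k) (shift k x) * (real k * nvol k x - (if k = 1 then 1 else 0))) =
        (\<Sum>k\<in>{1..<m}. real m * (H k * A k) - (if k = p then H k * A k else 0) - (if k = 1 then H k * A k else 0))"
      unfolding sum.distrib[symmetric]
    proof (intro sum.cong refl)
      fix k assume k: "k \<in> {1..<m}"
      then have "m - k = 1 \<longleftrightarrow> k = p" "real (m - k) = real m - real k" by (auto simp: m)
      then show "H k * nvol k x * (real (m - k) * nvol (m - k) (shift k x) - (if m - k = 1 then 1 else 0)) +
        H k * nvol (m - k) (shift k x) * (real k * nvol k x - (if k = 1 then 1 else 0)) =
        real m * (H k * A k) - (if k = p then H k * A k else 0) - (if k = 1 then H k * A k else 0)"
        by (auto simp: A_def algebra_simps m)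
    qed
    also have "\<dots> = real m * (\<Sum>k\<in>{1..<m}. H k * A k) - H p * A p - H 1 * A 1"
      unfolding sum_subtractf sum_distrib_left[symmetric] using p by (simp add: m)
    also have "(\<Sum>k\<in>{1..<m}. H k * A k) = real p * nvol m x"
      using nvol_rec[OF less.prems(1), of x] by (simp add: H_def A_def m mult.assoc)
    finally have "real p * (\<Sum>j\<in>{1..<m}. slice_int p j x) = real p * (real m * nvol m x)"
      by (simp add: algebra_simps)
    then show ?thesis using p m False by simp
  qed simp
qed

section \<open>The permutohedron by inequalities\<close>

lemma decr_mono:
  assumes "decr m x" "1 \<le> i" "i \<le> k" "k \<le> m"
  shows "x k \<le> x i"
  using assms(3,4)
proof (induction k rule: dec_induct)
  case (step k)
  then have "x (Suc k) \<le> x k"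
    using assms(1,2) by (simp add: decr_def)
  with step show ?case by simp
qed simp

lemma decr_shift: "decr m x \<Longrightarrow> k \<le> m \<Longrightarrow> decr (m - k) (shift k x)"
  by (auto simp: decr_def shift_def)

lemma decr_mono_dim: "decr m x \<Longrightarrow> k \<le> m \<Longrightarrow> decr k x"
  by (auto simp: decr_def)

lemma decr_slice:
  assumes "decr (Suc m) x" "j \<in> {1..m}" "x (Suc j) \<le> c" "c \<le> x j"
  shows "decr m (slice j c x)"
proof -
  have s: "x (Suc i) \<le> x i" if "i \<in> {1..m}" for i
    using assms(1) that by (simp add: decr_def)
  show ?thesis
    unfolding decr_def
  proof
    fix i assume i: "i \<in> {1..<m}"
    consider "Suc i < j" | "Suc i = j" | "i = j" | "j < i" by linarith
    then show "slice j c x (Suc i) \<le> slice j c x i"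
    proof cases
      case 2
      then show ?thesis using s[of i] assms i by (simp add: slice_def)
    next
      case 3
      then show ?thesis using s[of "Suc i"] assms i by (simp add: slice_def)
    qed (use s[of i] s[of "Suc i"] i in \<open>auto simp: slice_def\<close>)
  qed
qed

lemma psum_ge: "decr m x \<Longrightarrow> k \<le> m \<Longrightarrow> real k * x k \<le> psum x k"
  using sum_bounded_below[of "{1..k}" "x k" x] decr_mono[of m x _ k] by (simp add: psum_def)

lemma psum_diff_le:
  assumes "decr m x" "1 \<le> k" "k \<le> m"
  shows "psum x m - psum x k \<le> real (m - k) * x k"
proof -
  have "psum x m - psum x k = psum (shift k x) (m - k)"
    using assms(3) by (simp add: psum_shift)
  also have "\<dots> \<le> real (m - k) * x k"
    unfolding psum_def shift_def using assms
    by (intro sum_bounded_above[where K = "x k", THEN order_trans]) (auto intro!: decr_mono[OF assms(1)])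
  finally show ?thesis .
qed

text \<open>\<open>x k\<close> separates the average of the first \<open>k\<close> entries from that
  of the others.\<close>

lemma height_nonneg:
  assumes "decr m x" "k \<in> {1..<m}"
  shows "0 \<le> height m x k"
proof -
  have "real k * (psum x m - psum x k) \<le> real k * (real (m - k) * x k)"
    using assms by (intro mult_left_mono psum_diff_le) auto
  also have "\<dots> = real (m - k) * (real k * x k)" by simp
  also have "\<dots> \<le> real (m - k) * psum x k"
    using assms by (intro mult_left_mono psum_ge) auto
  finally have "real k * psum x m \<le> real m * psum x k"
    using assms by (simp add: of_nat_diff algebra_simps)
  then show ?thesis using assms by (simp add: height_def field_simps)
qed

lemma nvol_nonneg: "decr m x \<Longrightarrow> 0 \<le> nvol m x"
proof (induction m arbitrary: x rule: less_induct)
  case (less m)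
  have "0 \<le> height m x k * nvol k x * nvol (m - k) (shift k x)" if "k \<in> {1..<m}" for k
    using that less.prems
    by (intro mult_nonneg_nonneg height_nonneg less.IH) (auto intro: decr_shift decr_mono_dim)
  then show ?case by (auto simp: nvol.simps[of m] intro!: divide_nonneg_nonneg sum_nonneg)
qed

text \<open>The inequalities after elimination of the last coordinate, which turns the bounds for index
  sets containing it into lower bounds.\<close>

definition hrep :: "nat \<Rightarrow> (nat \<Rightarrow> real) \<Rightarrow> (nat \<Rightarrow> real) \<Rightarrow> bool" where
  "hrep n x t \<longleftrightarrow> (\<forall>I\<subseteq>{1..n}. psum x (Suc n) - psum x (Suc n - card I) \<le> sum t I \<and>
     sum t I \<le> psum x (card I))"

lemma hrep_cong:
  assumes "\<And>i. i \<in> {1..n} \<Longrightarrow> s i = t i"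
  shows "hrep n x s \<longleftrightarrow> hrep n x t"
proof -
  have "sum s I = sum t I" if "I \<subseteq> {1..n}" for I
    using assms that by (intro sum.cong) auto
  then show ?thesis by (simp add: hrep_def cong: conj_cong)
qed

lemma ball_subset_atLeastAtMost_Suc:
  "(\<forall>I\<subseteq>{1..Suc p}. P I) \<longleftrightarrow> (\<forall>I\<subseteq>{1..p}. P I \<and> P (insert (Suc p) I))"
proof (intro iffI allI impI)
  fix I assume *: "\<forall>I\<subseteq>{1..Suc p}. P I" and "I \<subseteq> {1..p}"
  then have "I \<subseteq> {1..Suc p}" "insert (Suc p) I \<subseteq> {1..Suc p}" by auto
  with * show "P I \<and> P (insert (Suc p) I)" by blast
next
  fix I assume *: "\<forall>I\<subseteq>{1..p}. P I \<and> P (insert (Suc p) I)" and I: "I \<subseteq> {1..Suc p}"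
  have "I - {Suc p} \<subseteq> {1..p}" using I by (auto simp: subset_iff le_Suc_eq)
  with * have "P (I - {Suc p})" "P (insert (Suc p) (I - {Suc p}))" by blast+
  then show "P I" by (cases "Suc p \<in> I") (simp_all add: insert_absorb)
qed

text \<open>A set \<open>I\<close> of \<open>k\<close> remaining coordinates has two upper bounds,
  \<open>psum x k\<close> and, when the fixed coordinate is added,
  \<open>psum x (Suc k) - c\<close>. The first is the sharper one for \<open>c <= x (Suc k)\<close>,
  thus for \<open>k < j\<close>, the second for \<open>k >= j\<close>; this is exactly
  \<open>psum_slice\<close>. The lower bounds behave alike with \<open>r\<close> in place of
  \<open>k\<close>.\<close>

lemma hrep_slice:
  assumes x: "decr (Suc (Suc p)) x" and j: "j \<in> {1..Suc p}" and c: "x (Suc j) \<le> c" "c \<le> x j"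
  shows "hrep (Suc p) x (t(Suc p := c)) \<longleftrightarrow> hrep p (slice j c x) t"
  unfolding hrep_def ball_subset_atLeastAtMost_Suc
proof (intro all_cong1 imp_cong refl)
  fix I assume I: "I \<subseteq> {1..p}"
  then have fin: "finite I" and notin: "Suc p \<notin> I" by (auto simp: finite_subset)
  define k where "k = card I"
  have k: "k \<le> p" using card_mono[OF _ I] by (simp add: k_def)
  define T where "T = sum t I"
  define r where "r = Suc p - k"
  have [simp]: "Suc (Suc p) - k = Suc r" "Suc p - k = r" "r \<le> Suc p" "1 \<le> r"
    using k by (auto simp: r_def)
  have sums: "sum (t(Suc p := c)) I = T" "sum (t(Suc p := c)) (insert (Suc p) I) = c + T"
    "card (insert (Suc p) I) = Suc k"
    using fin notin by (auto simp: T_def k_def intro!: sum.cong)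
  have le: "c \<le> x (Suc i)" if "i < j" for i
    using decr_mono[OF x, of "Suc i" j] that j c by auto
  have ge: "x (Suc i) \<le> c" if "j \<le> i" "i \<le> Suc p" for i
    using decr_mono[OF x, of "Suc j" "Suc i"] that c by auto
  have "j \<ge> 1" using j by simp
  note ps = psum_slice[OF this]
  have "T \<le> psum (slice j c x) k \<longleftrightarrow> T \<le> psum x k \<and> c + T \<le> psum x (Suc k)"
    using le[of k] ge[of k] k by (auto simp: ps psum_Suc)
  moreover have "psum (slice j c x) (Suc p) - psum (slice j c x) r \<le> T \<longleftrightarrow>
    psum x (Suc (Suc p)) - psum x (Suc r) \<le> T \<and> psum x (Suc (Suc p)) - psum x r \<le> c + T"
    using le[of r] ge[of r] j by (auto simp: ps psum_Suc[of x r])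
  ultimately show "((psum x (Suc (Suc p)) - psum x (Suc (Suc p) - card I) \<le> sum (t(Suc p := c)) I \<and>
      sum (t(Suc p := c)) I \<le> psum x (card I)) \<and>
      psum x (Suc (Suc p)) - psum x (Suc (Suc p) - card (insert (Suc p) I)) \<le> sum (t(Suc p := c)) (insert (Suc p) I) \<and>
      sum (t(Suc p := c)) (insert (Suc p) I) \<le> psum x (card (insert (Suc p) I))) =
      (psum (slice j c x) (Suc p) - psum (slice j c x) (Suc p - card I) \<le> sum t I \<and>
      sum t I \<le> psum (slice j c x) (card I))"
    unfolding sums by (auto simp flip: k_def T_def)
qed

lemma hrep_coord:
  assumes "hrep n x t" "i \<in> {1..n}"
  shows "x (Suc n) \<le> t i" "t i \<le> x 1"
  using assms unfolding hrep_def by (auto dest!: spec[of _ "{i}"] simp: psum_Suc)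

lemma obtain_segment:
  assumes "x (Suc n) \<le> (c :: real)" "c \<le> x 1" "1 \<le> n"
  obtains j where "j \<in> {1..n}" "x (Suc j) \<le> c" "c \<le> x j"
proof -
  have "\<exists>j\<in>{1..n}. x (Suc j) \<le> c \<and> c \<le> x j"
    using assms(3,1)
  proof (induction n rule: dec_induct)
    case base
    then show ?case using assms(2) by auto
  next
    case (step n)
    then show ?case by (cases "x (Suc n) \<le> c") (force intro: bexI[of _ "Suc n"])+
  qed
  then show thesis using that by blast
qed

lemma psum_ge_sum:
  assumes "decr m x" "J \<subseteq> {1..m}"
  shows "sum x J \<le> psum x (card J)"
  using assms
proof (induction m arbitrary: J)
  case (Suc m)
  note d = decr_mono_dim[OF Suc.prems(1), of m]
  show ?case
  proof (cases "Suc m \<in> J")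
    case False
    then have "J \<subseteq> {1..m}" using Suc.prems(2) by (auto simp: subset_iff le_Suc_eq)
    then show ?thesis using Suc.IH d by simp
  next
    case True
    define J' where "J' = J - {Suc m}"
    have J': "J' \<subseteq> {1..m}" using Suc.prems(2) by (auto simp: J'_def subset_iff le_Suc_eq)
    have J: "J = insert (Suc m) J'" "Suc m \<notin> J'" "finite J'"
      using True finite_subset[OF J'] by (auto simp: J'_def)
    have "card J' \<le> m" using card_mono[OF _ J'] by simp
    then have "x (Suc m) \<le> x (Suc (card J'))" using Suc.prems(1) by (intro decr_mono) auto
    moreover have "sum x J' \<le> psum x (card J')" using Suc.IH d J' by simp
    ultimately show ?thesis using J by (simp add: psum_Suc)
  qed
qed simp

lemma psum_le_sum:
  assumes "decr m x" "J \<subseteq> {1..m}"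
  shows "psum x m - psum x (m - card J) \<le> sum x J"
proof -
  have "sum x ({1..m} - J) \<le> psum x (card ({1..m} - J))"
    using assms by (intro psum_ge_sum) auto
  moreover have "card ({1..m} - J) = m - card J"
    using assms by (subst card_Diff_subset) (auto simp: finite_subset)
  moreover have "sum x ({1..m} - J) = psum x m - sum x J"
    unfolding psum_def using assms by (intro sum_diff) auto
  ultimately show ?thesis by simp
qed

section \<open>Vertices and Rado's theorem\<close>

definition vertex :: "nat \<Rightarrow> (nat \<Rightarrow> real) \<Rightarrow> nat \<Rightarrow> real" where
  "vertex m x = (\<lambda>i. if i \<in> {1..m} then x i else 0)"

lemma permutohedron_eq:
  "permutohedron m x = convex hull {vertex m (x \<circ> w) | w. w permutes {1..m}}"
  by (simp add: permutohedron_def vertex_def comp_def)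

lemma convex_hrep: "convex {t. hrep n x t}"
proof (rule convexI, clarsimp)
  fix s t :: "nat \<Rightarrow> real" and a b :: real
  assume s: "hrep n x s" and t: "hrep n x t" and ab: "0 \<le> a" "0 \<le> b" "a + b = 1"
  show "hrep n x (a *\<^sub>R s + b *\<^sub>R t)"
    unfolding hrep_def
  proof (intro allI impI)
    fix I assume I: "I \<subseteq> {1..n}"
    define l u where "l = psum x (Suc n) - psum x (Suc n - card I)" and "u = psum x (card I)"
    have *: "l \<le> sum s I" "sum s I \<le> u" "l \<le> sum t I" "sum t I \<le> u"
      using s t I by (auto simp: hrep_def l_def u_def)
    have "sum (a *\<^sub>R s + b *\<^sub>R t) I = a * sum s I + b * sum t I"
      by (simp add: sum.distrib sum_distrib_left)
    moreover have "a * sum s I + b * sum t I \<in> {l..u}"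
      using convexD[OF convex_real_interval(5) _ _ ab, of "sum s I" l u "sum t I"] * by simp
    ultimately show "l \<le> sum (a *\<^sub>R s + b *\<^sub>R t) I \<and> sum (a *\<^sub>R s + b *\<^sub>R t) I \<le> u"
      by simp
  qed
qed

text \<open>The easy half of Rado's theorem: by convexity only vertices matter, and there a
  coordinate sum is a sum of \<open>card I\<close> entries of \<open>x\<close>.\<close>

lemma permutohedron_subset_hrep:
  assumes x: "decr (Suc n) x"
  shows "permutohedron (Suc n) x \<subseteq> {t. hrep n x t}"
  unfolding permutohedron_eq
proof (rule hull_minimal[where S = convex, OF _ convex_hrep], safe)
  fix w assume w: "w permutes {1..Suc n}"
  show "hrep n x (vertex (Suc n) (x \<circ> w))"
    unfolding hrep_def
  proof (intro allI impI)
    fix I assume I: "I \<subseteq> {1..n}"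
    have inj: "inj_on w I" using w by (meson permutes_inj_on)
    have "w ` I \<subseteq> w ` {1..Suc n}" using I by (intro image_mono) auto
    then have wI: "w ` I \<subseteq> {1..Suc n}" by (simp only: permutes_image[OF w])
    have "sum (vertex (Suc n) (x \<circ> w)) I = sum (x \<circ> w) I"
      using I by (intro sum.cong) (auto simp: vertex_def)
    also have "\<dots> = sum x (w ` I)" by (simp add: sum.reindex[OF inj])
    finally show "psum x (Suc n) - psum x (Suc n - card I) \<le> sum (vertex (Suc n) (x \<circ> w)) I \<and>
        sum (vertex (Suc n) (x \<circ> w)) I \<le> psum x (card I)"
      using psum_ge_sum[OF x wI] psum_le_sum[OF x wI] by (simp add: card_image[OF inj])
  qed
qed
text \<open>Next to \<open>c\<close>, the sliced vector has the entries of \<open>x\<close> with the pair \<open>x j\<close>, \<open>x (Suc j)\<close> replaced by a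
  pair of equal sum between them, so it is a convex combination of two rearrangements of \<open>x\<close>.\<close>

definition gap_perm :: "nat \<Rightarrow> nat \<Rightarrow> nat \<Rightarrow> nat" where
  "gap_perm m j = (\<lambda>i. if i \<le> j \<or> m < i then i else if i = m then Suc j else Suc i)"

lemma gap_perm_permutes:
  assumes "j \<in> {1..<m}"
  shows "gap_perm m j permutes {1..m}"
proof (rule bij_imp_permutes)
  show "bij_betw (gap_perm m j) {1..m} {1..m}"
    by (rule bij_betw_byWitness[where f' = "\<lambda>i. if i \<le> j then i else if i = Suc j then m else i - 1"])
      (use assms in \<open>auto simp: gap_perm_def\<close>)
qed (use assms in \<open>auto simp: gap_perm_def\<close>)

lemma vertex_in_permutohedron:
  "w permutes {1..m} \<Longrightarrow> vertex m (x \<circ> w) \<in> permutohedron m x"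
  unfolding permutohedron_eq by (rule hull_inc) blast

lemma convex_permutohedron: "convex (permutohedron m x)"
  by (simp add: permutohedron_eq)

lemma vertex_slice_in_permutohedron:
  assumes j: "j \<in> {1..m}" and c: "x (Suc j) \<le> c" "c \<le> x j"
    and w: "w permutes {1..Suc m}"
  shows "vertex (Suc m) (((slice j c x)(Suc m := c)) \<circ> w) \<in> permutohedron (Suc m) x"
proof -
  \<comment> \<open>Taking the weights from \<open>closed_segment\<close> avoids a division and so
    covers \<open>x j = x (Suc j)\<close>.\<close>
  obtain a b where ab: "0 \<le> a" "0 \<le> b" "a + b = 1" and c_eq: "c = a * x (Suc j) + b * x j"
  proof -
    have "c \<in> closed_segment (x (Suc j)) (x j)"
      using c by (simp add: closed_segment_eq_real_ivl)
    then obtain v where v: "0 \<le> v" "v \<le> 1" "c = (1 - v) * x (Suc j) + v * x j"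
      by (auto simp: closed_segment_def)
    show thesis by (rule that[of "1 - v" v]) (use v in auto)
  qed
  \<comment> \<open>\<open>?s\<close> lists \<open>x\<close> with \<open>x (Suc j)\<close> moved to
    the end, and \<open>?t\<close> exchanges it with \<open>x j\<close>. With weights
    \<open>a\<close> and \<open>b\<close> the last entry becomes \<open>c\<close> and entry
    \<open>j\<close> becomes \<open>x j + x (Suc j) - c\<close>.\<close>
  let ?s = "gap_perm (Suc m) j"
  let ?t = "Transposition.transpose j (Suc j)"
  have s: "?s permutes {1..Suc m}" and t: "?t permutes {1..Suc m}"
    using j by (intro gap_perm_permutes permutes_swap_id; auto)+
  have eq: "((slice j c x)(Suc m := c)) i = a * (x \<circ> ?s) i + b * (x \<circ> (?t \<circ> ?s)) i"
    if i: "i \<in> {1..Suc m}" for i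
  proof -
    have b: "b = 1 - a" using ab by simp
    consider "i < j" | "i = j" | "j < i" "i < Suc m" | "i = Suc m" using i by force
    then show ?thesis
    proof cases
      case 4
      then show ?thesis using j by (simp add: gap_perm_def c_eq)
    qed (use j in \<open>auto simp: gap_perm_def slice_def c_eq b transpose_def algebra_simps\<close>)
  qed
  have "vertex (Suc m) (((slice j c x)(Suc m := c)) \<circ> w) =
     a *\<^sub>R vertex (Suc m) (x \<circ> (?s \<circ> w)) + b *\<^sub>R vertex (Suc m) (x \<circ> (?t \<circ> ?s \<circ> w))"
  proof
    fix i
    show "vertex (Suc m) (((slice j c x)(Suc m := c)) \<circ> w) i =
     (a *\<^sub>R vertex (Suc m) (x \<circ> (?s \<circ> w)) + b *\<^sub>R vertex (Suc m) (x \<circ> (?t \<circ> ?s \<circ> w))) i"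
    proof (cases "i \<in> {1..Suc m}")
      case True
      then have "w i \<in> {1..Suc m}" using permutes_in_image[OF w] by blast
      from eq[OF this] True show ?thesis
        by (simp only: vertex_def comp_def plus_fun_apply scaleR_fun_apply if_True real_scaleR_def)
    qed (auto simp only: vertex_def plus_fun_apply scaleR_fun_apply if_False scaleR_zero_right)
  qed
  moreover have "vertex (Suc m) (x \<circ> (?s \<circ> w)) \<in> permutohedron (Suc m) x"
    "vertex (Suc m) (x \<circ> (?t \<circ> ?s \<circ> w)) \<in> permutohedron (Suc m) x"
    by (intro vertex_in_permutohedron permutes_compose w s t)+
  ultimately show ?thesis
    using convexD[OF convex_permutohedron _ _ ab] by simp
qed

text \<open>The last coordinate is the one determined by the total and forgotten by the projection.
  Hence \<open>c\<close> enters at \<open>m\<close>, and the old dependent coordinate moves up to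
  \<open>m + 1\<close>.\<close>

definition append_coord :: "nat \<Rightarrow> real \<Rightarrow> (nat \<Rightarrow> real) \<Rightarrow> nat \<Rightarrow> real" where
  "append_coord m c f = (\<lambda>i. if i = m then c else if i = Suc m then f m else f i)"

text \<open>For fixed \<open>c\<close> the extension respects convex combinations, so only vertices
  of the slice need checking. They are covered by \<open>vertex_slice_in_permutohedron\<close> after
  a transposition of the last two positions.\<close>

lemma append_coord_in_permutohedron:
  assumes m: "1 \<le> m" and j: "j \<in> {1..m}" and c: "x (Suc j) \<le> c" "c \<le> x j"
    and f: "f \<in> permutohedron m (slice j c x)"
  shows "append_coord m c f \<in> permutohedron (Suc m) x"
proof -
  have "permutohedron m (slice j c x) \<subseteq> {f. append_coord m c f \<in> permutohedron (Suc m) x}"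
    unfolding permutohedron_eq[of m]
  proof (rule hull_minimal[where S = convex])
    show "convex {f. append_coord m c f \<in> permutohedron (Suc m) x}"
    proof (rule convexI, clarsimp)
      fix f g :: "nat \<Rightarrow> real" and a b :: real
      assume fg: "append_coord m c f \<in> permutohedron (Suc m) x" "append_coord m c g \<in> permutohedron (Suc m) x"
        and ab: "0 \<le> a" "0 \<le> b" "a + b = 1"
      have "a * c + b * c = c" using ab by (simp flip: distrib_right)
      then have "append_coord m c (a *\<^sub>R f + b *\<^sub>R g) = a *\<^sub>R append_coord m c f + b *\<^sub>R append_coord m c g"
        by (auto simp: append_coord_def fun_eq_iff)
      then show "append_coord m c (a *\<^sub>R f + b *\<^sub>R g) \<in> permutohedron (Suc m) x"
        using convexD[OF convex_permutohedron fg ab] by simp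
    qed
  next
    show "{vertex m (slice j c x \<circ> w) |w. w permutes {1..m}} \<subseteq> {f. append_coord m c f \<in> permutohedron (Suc m) x}"
    proof safe
      fix w assume w: "w permutes {1..m}"
      let ?w = "w \<circ> Transposition.transpose m (Suc m)"
      have w': "w permutes {1..Suc m}" using w by (rule permutes_subset) auto
      have "?w permutes {1..Suc m}"
        by (rule permutes_compose[OF _ w']) (use m in \<open>auto intro: permutes_swap_id\<close>)
      from vertex_slice_in_permutohedron[OF j c this]
      have "vertex (Suc m) (((slice j c x)(Suc m := c)) \<circ> ?w) \<in> permutohedron (Suc m) x" .
      moreover have "vertex (Suc m) (((slice j c x)(Suc m := c)) \<circ> ?w) = append_coord m c (vertex m (slice j c x \<circ> w))"
      proof
        fix i
        have "w (Suc m) = Suc m" using w by (auto simp: permutes_def)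
        moreover have "w i \<noteq> Suc m" if "i \<in> {1..m}" for i
          using permutes_in_image[OF w, of i] that by auto
        ultimately show "vertex (Suc m) (((slice j c x)(Suc m := c)) \<circ> ?w) i = append_coord m c (vertex m (slice j c x \<circ> w)) i"
          using m by (auto simp: vertex_def append_coord_def transpose_def)
      qed
      ultimately show "append_coord m c (vertex m (slice j c x \<circ> w)) \<in> permutohedron (Suc m) x" by simp
    qed
  qed
  with f show ?thesis by blast
qed

text \<open>Rado's theorem, by induction on the dimension through the slices.\<close>

lemma hrep_in_permutohedron:
  assumes "decr (Suc n) x" "hrep n x t"
  shows "(\<lambda>i. if i \<in> {1..n} then t i else if i = Suc n then psum x (Suc n) - sum t {1..n} else 0)
    \<in> permutohedron (Suc n) x"
  using assms
proof (induction n arbitrary: x t)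
  case 0
  have "vertex (Suc 0) (x \<circ> id) \<in> permutohedron (Suc 0) x"
    by (rule vertex_in_permutohedron[OF permutes_id])
  moreover have "vertex (Suc 0) (x \<circ> id) = (\<lambda>i. if i = Suc 0 then x (Suc 0) else 0)"
    by (auto simp: vertex_def)
  ultimately show ?case by (simp add: psum_Suc cong: if_cong)
next
  case (Suc p)
  define c where "c = t (Suc p)"
  have "x (Suc (Suc p)) \<le> c" "c \<le> x 1"
    unfolding c_def using hrep_coord[OF Suc.prems(2), of "Suc p"] by auto
  then obtain j where j: "j \<in> {1..Suc p}" and c: "x (Suc j) \<le> c" "c \<le> x j"
    using obtain_segment[of x "Suc p" c] by auto
  define y where "y = slice j c x"
  let ?f = "\<lambda>i. if i \<in> {1..p} then t i else if i = Suc p then psum y (Suc p) - sum t {1..p} else 0"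
  have "hrep p y t"
    using Suc.prems(2) hrep_slice[OF Suc.prems(1) j c, of t] by (simp add: c_def y_def)
  moreover have "decr (Suc p) y"
    unfolding y_def by (rule decr_slice[OF Suc.prems(1) j c])
  ultimately have "?f \<in> permutohedron (Suc p) y" by (intro Suc.IH)
  then have "append_coord (Suc p) c ?f \<in> permutohedron (Suc (Suc p)) x"
    unfolding y_def by (intro append_coord_in_permutohedron[OF _ j c]) auto
  moreover have "psum y (Suc p) = psum x (Suc (Suc p)) - c"
    using j by (simp add: y_def psum_slice)
  then have "append_coord (Suc p) c ?f = (\<lambda>i. if i \<in> {1..Suc p} then t i
      else if i = Suc (Suc p) then psum x (Suc (Suc p)) - sum t {1..Suc p} else 0)"
    by (auto simp: append_coord_def c_def fun_eq_iff)
  ultimately show ?case by simp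
qed

definition proj_perm :: "nat \<Rightarrow> (nat \<Rightarrow> real) \<Rightarrow> (nat \<Rightarrow> real) set" where
  "proj_perm n x = {t \<in> space (\<Pi>\<^sub>M i\<in>{1..n}. lborel). hrep n x t}"

lemma restrict_image_permutohedron:
  assumes x: "decr (Suc n) x"
  shows "(\<lambda>t. restrict t {1..n}) ` permutohedron (Suc n) x = proj_perm n x"
proof (intro equalityI subsetI)
  fix t assume "t \<in> (\<lambda>t. restrict t {1..n}) ` permutohedron (Suc n) x"
  then obtain s where s: "s \<in> permutohedron (Suc n) x" and t: "t = restrict s {1..n}" by blast
  have "hrep n x s" using permutohedron_subset_hrep[OF x] s by blast
  then have "hrep n x t" using hrep_cong[of n s t x] by (simp add: t)
  then show "t \<in> proj_perm n x" by (simp add: proj_perm_def space_PiM t)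
next
  fix t assume t: "t \<in> proj_perm n x"
  let ?s = "\<lambda>i. if i \<in> {1..n} then t i else if i = Suc n then psum x (Suc n) - sum t {1..n} else 0"
  have "?s \<in> permutohedron (Suc n) x"
    using t by (intro hrep_in_permutohedron x) (simp add: proj_perm_def)
  moreover have "t = restrict ?s {1..n}"
    using t by (auto simp: proj_perm_def space_PiM restrict_def fun_eq_iff PiE_def extensional_def)
  ultimately show "t \<in> (\<lambda>t. restrict t {1..n}) ` permutohedron (Suc n) x" by blast
qed

section \<open>Volume by Fubini\<close>

interpretation lborel_product: product_sigma_finite "\<lambda>_ :: nat. lborel :: real measure" ..

lemma proj_perm_measurable [measurable]: "proj_perm n x \<in> sets (\<Pi>\<^sub>M i\<in>{1..n}. lborel)"
proof -
  let ?M = "\<Pi>\<^sub>M i\<in>{1..n}. lborel :: real measure"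
  have eq: "proj_perm n x = (\<Inter>I\<in>Pow {1..n}. {t \<in> space ?M.
      psum x (Suc n) - psum x (Suc n - card I) \<le> sum t I \<and> sum t I \<le> psum x (card I)})"
    by (auto simp: proj_perm_def hrep_def)
  have "{t \<in> space ?M. psum x (Suc n) - psum x (Suc n - card I) \<le> sum t I \<and> sum t I \<le> psum x (card I)}
      \<in> sets ?M" if "I \<in> Pow {1..n}" for I
  proof -
    have [measurable]: "(\<lambda>t. sum t I) \<in> borel_measurable ?M"
      using that by (intro borel_measurable_sum) (auto intro!: measurable_component_singleton)
    show ?thesis by measurable
  qed
  then show ?thesis unfolding eq by (intro sets.finite_INT) auto
qed

lemma emeasure_proj_perm_Suc:
  "emeasure (\<Pi>\<^sub>M i\<in>{1..Suc p}. lborel) (proj_perm (Suc p) x) =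
    (\<integral>\<^sup>+ c. emeasure (\<Pi>\<^sub>M i\<in>{1..p}. lborel)
      {t \<in> space (\<Pi>\<^sub>M i\<in>{1..p}. lborel). hrep (Suc p) x (t(Suc p := c))} \<partial>lborel)"
proof -
  let ?M = "\<lambda>n. \<Pi>\<^sub>M i\<in>{1..n}. lborel :: real measure"
  have ins: "{1..Suc p} = insert (Suc p) {1..p}" by auto
  have space: "t(Suc p := c) \<in> space (?M (Suc p))" if "t \<in> space (?M p)" for t c
    using that unfolding ins by (auto simp: space_PiM PiE_def extensional_def)
  have meas: "indicator (proj_perm (Suc p) x) \<in> borel_measurable (\<Pi>\<^sub>M i\<in>insert (Suc p) {1..p}. lborel)"
    using proj_perm_measurable[of "Suc p" x] unfolding ins by (rule borel_measurable_indicator)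
  have "emeasure (?M (Suc p)) (proj_perm (Suc p) x) = integral\<^sup>N (?M (Suc p)) (indicator (proj_perm (Suc p) x))"
    by (rule nn_integral_indicator[OF proj_perm_measurable, symmetric])
  also have "\<dots> = (\<integral>\<^sup>+ c. (\<integral>\<^sup>+ t. indicator (proj_perm (Suc p) x) (t(Suc p := c)) \<partial>?M p) \<partial>lborel)"
    unfolding ins by (rule lborel_product.product_nn_integral_insert_rev[OF _ _ meas]) auto
  also have "\<dots> = (\<integral>\<^sup>+ c. emeasure (?M p) {t \<in> space (?M p). hrep (Suc p) x (t(Suc p := c))} \<partial>lborel)"
  proof (intro nn_integral_cong)
    fix c :: real
    let ?A = "{t \<in> space (?M p). hrep (Suc p) x (t(Suc p := c))}"
    have upd: "(\<lambda>t. t(Suc p := c)) \<in> measurable (?M p) (?M (Suc p))"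
      unfolding ins by (rule measurable_fun_upd[where J = "{1..p}"]) auto
    have "?A = (\<lambda>t. t(Suc p := c)) -` proj_perm (Suc p) x \<inter> space (?M p)"
      using space by (auto simp: proj_perm_def)
    then have A: "?A \<in> sets (?M p)"
      using measurable_sets[OF upd proj_perm_measurable] by simp
    have "(\<integral>\<^sup>+ t. indicator (proj_perm (Suc p) x) (t(Suc p := c)) \<partial>?M p) = (\<integral>\<^sup>+ t. indicator ?A t \<partial>?M p)"
      using space by (intro nn_integral_cong) (auto simp: proj_perm_def split: split_indicator)
    then show "(\<integral>\<^sup>+ t. indicator (proj_perm (Suc p) x) (t(Suc p := c)) \<partial>?M p) = emeasure (?M p) ?A"
      using A by simp
  qed
  finally show ?thesis .
qed

lemma emeasure_proj_perm:
  assumes "decr (Suc n) x"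
  shows "emeasure (\<Pi>\<^sub>M i\<in>{1..n}. lborel) (proj_perm n x) = ennreal (fact (Suc n) * nvol (Suc n) x)"
  using assms
proof (induction n arbitrary: x)
  case 0
  have "proj_perm 0 x = {\<lambda>_. undefined}"
    by (auto simp: proj_perm_def hrep_def space_PiM)
  then show ?case by (simp add: PiM_empty)
next
  case (Suc p)
  define G where "G c = emeasure (\<Pi>\<^sub>M i\<in>{1..p}. lborel)
      {t \<in> space (\<Pi>\<^sub>M i\<in>{1..p}. lborel). hrep (Suc p) x (t(Suc p := c))}" for c
  have G: "G c = ennreal (fact (Suc p) * nvol (Suc p) (slice j c x))"
    if "j \<in> {1..Suc p}" "x (Suc j) \<le> c" "c \<le> x j" for j c
    unfolding G_def hrep_slice[OF Suc.prems that] proj_perm_def[symmetric]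
    by (rule Suc.IH[OF decr_slice[OF Suc.prems that]])
  have G_eq: "enn2real (G c) = fact (Suc p) * nvol (Suc p) (slice j c x)"
    if "j \<in> {1..Suc p}" "x (Suc j) \<le> c" "c \<le> x j" for j c
    using G[OF that] nvol_nonneg[OF decr_slice[OF Suc.prems that]] by simp
  \<comment> \<open>The formula for \<open>G\<close> changes at every \<open>x j\<close>, so the
    interval is built downwards from the point \<open>x 1\<close>, one segment at a time.\<close>
  have int: "((\<lambda>c. enn2real (G c)) has_integral fact (Suc p) * (\<Sum>j\<in>{1..<Suc q}. slice_int (Suc p) j x))
      {x (Suc q)..x 1}" if "q \<le> Suc p" for q
    using that
  proof (induction q)
    case (Suc q)
    have seg: "((\<lambda>c. enn2real (G c)) has_integral fact (Suc p) * slice_int (Suc p) (Suc q) x)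
        {x (Suc (Suc q))..x (Suc q)}"
    proof (rule has_integral_eq)
      show "((\<lambda>c. fact (Suc p) * nvol (Suc p) (slice (Suc q) c x)) has_integral
          fact (Suc p) * slice_int (Suc p) (Suc q) x) {x (Suc (Suc q))..x (Suc q)}"
        using Suc.prems by (intro has_integral_mult_right nvol_slice_has_integral) auto
      fix c assume "c \<in> {x (Suc (Suc q))..x (Suc q)}"
      then show "fact (Suc p) * nvol (Suc p) (slice (Suc q) c x) = enn2real (G c)"
        using Suc.prems by (intro G_eq[symmetric]) auto
    qed
    have "((\<lambda>c. enn2real (G c)) has_integral fact (Suc p) * slice_int (Suc p) (Suc q) x +
        fact (Suc p) * (\<Sum>j\<in>{1..<Suc q}. slice_int (Suc p) j x)) {x (Suc (Suc q))..x 1}"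
      by (rule has_integral_combine[OF _ _ seg Suc.IH])
        (use Suc.prems in \<open>auto intro!: decr_mono[OF \<open>decr (Suc (Suc p)) x\<close>]\<close>)
    then show ?case by (simp add: algebra_simps)
  qed (use has_integral_refl(2)[of "\<lambda>c. enn2real (G c)" "x 1"] in simp)
  \<comment> \<open>Sections are empty outside this interval and of finite measure inside it, so
    nothing is lost by passing to real integrals.\<close>
  have "G c = ennreal (enn2real (G c)) * indicator {x (Suc (Suc p))..x 1} c" for c
  proof (cases "c \<in> {x (Suc (Suc p))..x 1}")
    case True
    then obtain j where "j \<in> {1..Suc p}" "x (Suc j) \<le> c" "c \<le> x j"
      using obtain_segment[of x "Suc p" c] by auto
    from G[OF this] have "G c < top" by simp
    then show ?thesis using True by simp
  next
    case False
    then have "\<not> hrep (Suc p) x (t(Suc p := c))" for t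
      using hrep_coord[of "Suc p" x "t(Suc p := c)" "Suc p"] by auto
    then show ?thesis using False by (simp add: G_def)
  qed
  then have "emeasure (\<Pi>\<^sub>M i\<in>{1..Suc p}. lborel) (proj_perm (Suc p) x) =
      (\<integral>\<^sup>+ c. ennreal (enn2real (G c)) * indicator {x (Suc (Suc p))..x 1} c \<partial>lborel)"
    unfolding emeasure_proj_perm_Suc G_def[symmetric] by (intro nn_integral_cong) simp
  also have "\<dots> = ennreal (fact (Suc p) * (\<Sum>j\<in>{1..<Suc (Suc p)}. slice_int (Suc p) j x))"
    by (intro nn_integral_has_integral_lebesgue' int) auto
  \<comment> \<open>The factor \<open>p + 2\<close> gained here turns \<open>fact (Suc p)\<close>
    into the next factorial.\<close>
  also have "(\<Sum>j\<in>{1..<Suc (Suc p)}. slice_int (Suc p) j x) = real (Suc (Suc p)) * nvol (Suc (Suc p)) x"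
    using sum_slice_int[OF _ Suc.prems] by simp
  finally show ?case by (simp add: mult_ac)
qed

lemma vol_proj_permutohedron:
  assumes "decr (Suc n) x"
  shows "vol_proj n (permutohedron (Suc n) x) = fact (Suc n) * nvol (Suc n) x"
  using emeasure_proj_perm[OF assms] nvol_nonneg[OF assms]
  unfolding vol_proj_def restrict_image_permutohedron[OF assms] measure_def by simp

section \<open>Binary trees\<close>

text \<open>By uniqueness it suffices that the proposed tree has the right shape and inorder list;
  labels on the right continue after the root's.\<close>

lemma bs_labeling_Node:
  "bs_labeling \<langle>l, u, r\<rangle> = \<langle>bs_labeling l, Suc (size l), map_tree (\<lambda>i. i + Suc (size l)) (bs_labeling r)\<rangle>"
    (is "_ = ?L")
proof -
  have l: "map_tree (\<lambda>_. ()) (bs_labeling l) = l" "inorder (bs_labeling l) = [1..<1 + size l]"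
    and r: "map_tree (\<lambda>_. ()) (bs_labeling r) = r" "inorder (bs_labeling r) = [1..<1 + size r]"
    using is_bs_labeling_bs_labeling by (auto simp: is_bs_labeling_iff_inorder)
  have shift: "map (\<lambda>i. i + k) [1..<1 + m] = [1 + k..<1 + m + k]" for k m
    by (rule nth_equalityI) (simp_all del: upt_Suc)
  have "inorder ?L = [1..<1 + size l] @ Suc (size l) # [Suc (Suc (size l))..<Suc (Suc (size l + size r))]"
    unfolding inorder.simps l inorder_map r shift by (simp add: add_ac del: upt_Suc)
  also have "\<dots> = [1..<1 + size \<langle>l, u, r\<rangle>]"
    by (rule nth_equalityI) (auto simp: nth_append nth_Cons' simp del: upt_Suc)
  finally have "is_bs_labeling \<langle>l, u, r\<rangle> ?L"
    using l r by (simp add: is_bs_labeling_iff_inorder tree.map_comp comp_def del: upt_Suc)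
  then show ?thesis using ex1_bs_labeling is_bs_labeling_bs_labeling by blast
qed

lemma set_bs_labeling: "set_tree (bs_labeling T) = {1..size T}"
  using is_bs_labeling_bs_labeling[of T] by (simp add: is_bs_labeling_def)

lemma subtrees_map_tree: "subtrees (map_tree f t) = map_tree f ` subtrees t"
  by (induction t) (auto simp: image_Un)

lemma subtrees_set_tree: "s \<in> subtrees t \<Longrightarrow> set_tree s \<subseteq> set_tree t"
  by (induction t) auto

lemma desc_subset: "desc j T \<subseteq> {1..size T}"
  unfolding desc_def using subtrees_set_tree[of _ "bs_labeling T"] set_bs_labeling[of T] by blast

lemma desc_self: "j \<in> {1..size T} \<Longrightarrow> j \<in> desc j T"
proof -
  have "a \<in> set_tree t \<Longrightarrow> \<exists>l r. \<langle>l, a, r\<rangle> \<in> subtrees t" for a :: nat and t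
    by (induction t) auto
  then show "j \<in> {1..size T} \<Longrightarrow> j \<in> desc j T"
    unfolding desc_def set_bs_labeling[symmetric] by fastforce
qed

text \<open>Left subtree, root and right subtree carry disjoint ranges of labels, so a label is
  found in just one of them; the next two lemmas rest on this too.\<close>

lemma desc_root: "desc (Suc (size l)) \<langle>l, u, r\<rangle> = {1..size \<langle>l, u, r\<rangle>}"
proof -
  have "\<langle>a, Suc (size l), b\<rangle> \<notin> subtrees (bs_labeling l)" for a b
    by (rule Node_notin_subtrees_if) (simp add: set_bs_labeling)
  moreover have "\<langle>a, Suc (size l), b\<rangle> \<notin> subtrees (map_tree (\<lambda>i. i + Suc (size l)) (bs_labeling r))" for a b
    by (rule Node_notin_subtrees_if) (auto simp: set_bs_labeling tree.set_map)
  ultimately have "desc (Suc (size l)) \<langle>l, u, r\<rangle> = set_tree (bs_labeling \<langle>l, u, r\<rangle>)"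
    by (auto simp: desc_def bs_labeling_Node)
  then show ?thesis by (simp add: set_bs_labeling)
qed

lemma desc_left:
  assumes "j \<le> size l"
  shows "desc j \<langle>l, u, r\<rangle> = desc j l"
proof -
  have "\<langle>a, j, b\<rangle> \<notin> subtrees (map_tree (\<lambda>i. i + Suc (size l)) (bs_labeling r))" for a b
    by (rule Node_notin_subtrees_if) (use assms in \<open>auto simp: set_bs_labeling tree.set_map\<close>)
  then show ?thesis using assms by (auto simp: desc_def bs_labeling_Node)
qed

lemma desc_right:
  assumes "1 \<le> j"
  shows "desc (j + Suc (size l)) \<langle>l, u, r\<rangle> = (\<lambda>i. i + Suc (size l)) ` desc j r"
proof -
  define k where "k = Suc (size l)"
  have "\<langle>a, j + k, b\<rangle> \<notin> subtrees (bs_labeling l)" for a b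
    by (rule Node_notin_subtrees_if) (auto simp: set_bs_labeling k_def)
  then have "desc (j + k) \<langle>l, u, r\<rangle> =
      {i. \<exists>a b. \<langle>a, j + k, b\<rangle> \<in> map_tree (\<lambda>i. i + k) ` subtrees (bs_labeling r) \<and> i \<in> set_tree \<langle>a, j + k, b\<rangle>}"
    using assms by (auto simp: desc_def bs_labeling_Node subtrees_map_tree k_def)
  also have "\<dots> = (\<lambda>i. i + k) ` desc j r"
  proof (intro equalityI subsetI)
    fix i assume "i \<in> {i. \<exists>a b. \<langle>a, j + k, b\<rangle> \<in> map_tree (\<lambda>i. i + k) ` subtrees (bs_labeling r) \<and> i \<in> set_tree \<langle>a, j + k, b\<rangle>}"
    then obtain a b where mem: "\<langle>a, j + k, b\<rangle> \<in> map_tree (\<lambda>i. i + k) ` subtrees (bs_labeling r)"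
      and i: "i \<in> set_tree \<langle>a, j + k, b\<rangle>" by blast
    from mem obtain s where s: "s \<in> subtrees (bs_labeling r)" "map_tree (\<lambda>i. i + k) s = \<langle>a, j + k, b\<rangle>"
      by (metis imageE)
    then obtain a' b' where s': "s = \<langle>a', j, b'\<rangle>" by (cases s) auto
    have "i \<in> (\<lambda>i. i + k) ` set_tree s" using i unfolding s(2)[symmetric] by (simp add: tree.set_map)
    then show "i \<in> (\<lambda>i. i + k) ` desc j r" using s(1) unfolding s' by (auto simp: desc_def)
  next
    fix i assume "i \<in> (\<lambda>i. i + k) ` desc j r"
    then obtain a b i' where ab: "\<langle>a, j, b\<rangle> \<in> subtrees (bs_labeling r)" and i': "i' \<in> set_tree \<langle>a, j, b\<rangle>" "i = i' + k"
      by (auto simp: desc_def)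
    from i' have "i \<in> set_tree (map_tree (\<lambda>i. i + k) \<langle>a, j, b\<rangle>)" unfolding tree.set_map by blast
    with ab show "i \<in> {i. \<exists>a b. \<langle>a, j + k, b\<rangle> \<in> map_tree (\<lambda>i. i + k) ` subtrees (bs_labeling r) \<and> i \<in> set_tree \<langle>a, j + k, b\<rangle>}"
      by (intro CollectI exI[of _ "map_tree (\<lambda>i. i + k) a"] exI[of _ "map_tree (\<lambda>i. i + k) b"]) force
  qed
  finally show ?thesis by (simp add: k_def)
qed

lemma h_root: "h (Suc (size l)) \<langle>l, u, r\<rangle> = size \<langle>l, u, r\<rangle>"
  by (simp only: h_def desc_root card_atLeastAtMost diff_Suc_1)

lemma wt_root: "wt \<langle>l, u, r\<rangle> i (Suc (size l)) =
  min (real i / real (Suc (size l)))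
    ((real (size \<langle>l, u, r\<rangle>) - real i + 1) / (real (size \<langle>l, u, r\<rangle>) - real (Suc (size l)) + 1))"
proof -
  have "Min {1..size \<langle>l, u, r\<rangle>} = 1" "Max {1..size \<langle>l, u, r\<rangle>} = size \<langle>l, u, r\<rangle>"
    by (auto intro!: Min_eqI Max_eqI)
  then show ?thesis by (simp only: wt_def desc_root Let_def of_nat_1 diff_add_cancel)
qed

lemma wt_right:
  assumes "j \<in> {1..size r}"
  shows "wt \<langle>l, u, r\<rangle> (i + Suc (size l)) (j + Suc (size l)) = wt r i j"
proof -
  have fin: "finite (desc j r)" by (rule finite_subset[OF desc_subset]) simp
  have ne: "desc j r \<noteq> {}" using desc_self[OF assms] by auto
  have "Min (desc (j + Suc (size l)) \<langle>l, u, r\<rangle>) = Min (desc j r) + Suc (size l)"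
    "Max (desc (j + Suc (size l)) \<langle>l, u, r\<rangle>) = Max (desc j r) + Suc (size l)"
    using assms mono_Min_commute[OF _ fin ne, of "\<lambda>i. i + Suc (size l)", symmetric]
      mono_Max_commute[OF _ fin ne, of "\<lambda>i. i + Suc (size l)", symmetric]
    by (simp_all add: desc_right mono_def del: add_Suc_right)
  then show ?thesis by (simp only: wt_def Let_def of_nat_add) simp
qed

text \<open>The summand without \<open>n!\<close>, with each \<open>h j T\<close> moved into the
  factor of its node, which makes it multiplicative over subtrees.\<close>

definition tree_weight :: "unit tree \<Rightarrow> (nat \<Rightarrow> real) \<Rightarrow> real" where
  "tree_weight T u = (\<Prod>j = 1..size T. (\<Sum>i\<in>desc j T. wt T i j * u i) / real (h j T))"

text \<open>The linear form of a root labeled \<open>k\<close> among \<open>n\<close> nodes. It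
  depends on the subtrees only through their sizes, so the sum over trees factors.\<close>

definition root_wt :: "nat \<Rightarrow> (nat \<Rightarrow> real) \<Rightarrow> nat \<Rightarrow> real" where
  "root_wt n u k = (\<Sum>i = 1..n. min (real i / real k) ((real n - real i + 1) / (real n - real k + 1)) * u i)"

lemma tree_weight_Leaf [simp]: "tree_weight Leaf u = 1"
  by (simp add: tree_weight_def)

lemma tree_weight_Node:
  "tree_weight \<langle>l, v, r\<rangle> u =
    root_wt (Suc (size l + size r)) u (Suc (size l)) / real (Suc (size l + size r)) *
    tree_weight l u * tree_weight r (\<lambda>i. u (i + Suc (size l)))"
proof -
  let ?T = "\<langle>l, v, r\<rangle>" and ?k = "Suc (size l)"
  let ?f = "\<lambda>j. (\<Sum>i\<in>desc j ?T. wt ?T i j * u i) / real (h j ?T)"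
  have "{1..size ?T} = {1..size l} \<union> ({?k} \<union> {1 + ?k..size r + ?k})" by auto
  then have "tree_weight ?T u = prod ?f {1..size l} * (?f ?k * prod ?f {1 + ?k..size r + ?k})"
    unfolding tree_weight_def by (subst prod.union_disjoint | simp)+
  also have "prod ?f {1..size l} = tree_weight l u"
    unfolding tree_weight_def
    by (intro prod.cong) (auto simp: desc_left h_def wt_def)
  also have "?f ?k = root_wt (size ?T) u ?k / real (size ?T)"
    by (simp only: h_root desc_root wt_root root_wt_def)
  also have "prod ?f {1 + ?k..size r + ?k} = (\<Prod>j = 1..size r. ?f (j + ?k))"
    by (rule prod.shift_bounds_cl_nat_ivl)
  also have "\<dots> = tree_weight r (\<lambda>i. u (i + ?k))"
    unfolding tree_weight_def
  proof (intro prod.cong refl)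
    fix j assume j: "j \<in> {1..size r}"
    then have d: "desc (j + ?k) ?T = (\<lambda>i. i + ?k) ` desc j r" by (intro desc_right) simp
    have inj: "inj_on (\<lambda>i. i + ?k) (desc j r)" by (simp add: inj_on_def)
    have "h (j + ?k) ?T = h j r" by (simp only: h_def d card_image[OF inj])
    then show "?f (j + ?k) = (\<Sum>i\<in>desc j r. wt r i j * u (i + ?k)) / real (h j r)"
      by (simp only: d sum.reindex[OF inj] comp_def wt_right[OF j])
  qed
  finally show ?thesis by (simp add: mult_ac)
qed

lemma sum_plane_binary_trees:
  fixes f :: "unit tree \<Rightarrow> real"
  assumes "1 \<le> n"
  shows "(\<Sum>T\<in>plane_binary_trees n. f T) =
    (\<Sum>k = 1..n. \<Sum>l\<in>plane_binary_trees (k - 1). \<Sum>r\<in>plane_binary_trees (n - k). f \<langle>l, (), r\<rangle>)"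
proof -
  have "(\<Sum>k = 1..n. \<Sum>l\<in>plane_binary_trees (k - 1). \<Sum>r\<in>plane_binary_trees (n - k). f \<langle>l, (), r\<rangle>) =
    (\<Sum>(k, l, r)\<in>Sigma {1..n} (\<lambda>k. plane_binary_trees (k - 1) \<times> plane_binary_trees (n - k)). f \<langle>l, (), r\<rangle>)"
    by (simp add: sum.Sigma sum.cartesian_product finite_plane_binary_trees case_prod_unfold)
  also have "\<dots> = (\<Sum>T\<in>plane_binary_trees n. f T)"
  proof (rule sum.reindex_bij_witness[of _ "\<lambda>T. (Suc (size (left T)), left T, right T)" "\<lambda>(k, l, r). \<langle>l, (), r\<rangle>"])
    fix T :: "unit tree" assume "T \<in> plane_binary_trees n"
    then show "(\<lambda>(k, l, r). \<langle>l, (), r\<rangle>) (Suc (size (left T)), left T, right T) = T"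
      "(Suc (size (left T)), left T, right T) \<in> Sigma {1..n} (\<lambda>k. plane_binary_trees (k - 1) \<times> plane_binary_trees (n - k))"
      using assms by (cases T; auto simp: plane_binary_trees_def)+
  qed (auto simp: plane_binary_trees_def)
  finally show ?thesis ..
qed

section \<open>Catalan numbers and the number of trees\<close>

definition catalan :: "nat \<Rightarrow> real" where
  "catalan n = real ((2 * n) choose n) / (real n + 1)"

lemma catalan_Suc: "(real n + 2) * catalan (Suc n) = (4 * real n + 2) * catalan n"
proof -
  define B C where "B = real ((2 * Suc n) choose Suc n)" and "C = real ((2 * n + 1) choose n)"
  have "(Suc n) * ((2 * Suc n) choose Suc n) = (2 * Suc n) * ((2 * n + 1) choose n)"
    using Suc_times_binomial[of n "2 * n + 1"] by simp
  then have "real ((Suc n) * ((2 * Suc n) choose Suc n)) = real ((2 * Suc n) * ((2 * n + 1) choose n))"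
    by (rule arg_cong)
  then have "real (Suc n) * B = 2 * real (Suc n) * C"
    unfolding B_def C_def of_nat_mult of_nat_numeral .
  then have "real (Suc n) * (B - 2 * C) = 0" by (simp add: algebra_simps)
  then have B: "B = 2 * C" by simp
  have "(Suc n) * ((2 * n + 1) choose n) = (2 * n + 1) * ((2 * n) choose n)"
    using Suc_times_binomial_add[of n n] Suc_times_binomial_eq[of "2*n" n] binomial_symmetric[of n "2 * n + 1"]
    by (simp add: mult_2 algebra_simps)
  then have "real ((Suc n) * ((2 * n + 1) choose n)) = real ((2 * n + 1) * ((2 * n) choose n))"
    by (rule arg_cong)
  then have "(real n + 1) * C = (2 * real n + 1) * real ((2 * n) choose n)"
    by (simp add: C_def algebra_simps)
  then have "2 * C = (4 * real n + 2) * (real ((2 * n) choose n) / (real n + 1))"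
    by (simp add: field_simps)
  moreover have "(real n + 2) * catalan (Suc n) = B"
    by (simp add: catalan_def B_def add.commute del: binomial_Suc_Suc)
  ultimately show ?thesis by (simp add: B catalan_def)
qed

text \<open>Reversing the convolution replaces a weight \<open>k\<close> by its mean
  \<open>m / 2\<close>, while \<open>catalan_Suc\<close> lowers the index in a term of weight
  \<open>k + 1\<close>. Evaluating one weighted sum both ways gives a first-order recursion for the
  convolution that matches \<open>catalan_Suc\<close>.\<close>

lemma sum_catalan: "(\<Sum>k\<le>n. catalan k * catalan (n - k)) = catalan (Suc n)"
proof (induction n)
  case 0
  show ?case by (simp add: catalan_def numeral_2_eq_2)
next
  case (Suc n)
  define S where "S m = (\<Sum>k\<le>m. catalan k * catalan (m - k))" for m
  have half: "2 * (\<Sum>k\<le>m. (real k + 1) * (catalan k * catalan (m - k))) = (real m + 2) * S m"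
    and "2 * (\<Sum>k\<le>m. real k * (catalan k * catalan (m - k))) = real m * S m" for m
  proof -
    have "(\<Sum>k\<le>m. real k * (catalan k * catalan (m - k))) = (\<Sum>k\<le>m. real (m - k) * (catalan k * catalan (m - k)))"
      by (rule sum.reindex_bij_witness[of _ "\<lambda>k. m - k" "\<lambda>k. m - k"]) auto
    then have "2 * (\<Sum>k\<le>m. real k * (catalan k * catalan (m - k))) =
      (\<Sum>k\<le>m. real k * (catalan k * catalan (m - k)) + real (m - k) * (catalan k * catalan (m - k)))"
      by (simp add: sum.distrib)
    also have "\<dots> = real m * S m"
      unfolding S_def sum_distrib_left by (intro sum.cong) (auto simp: of_nat_diff algebra_simps)
    finally show *: "2 * (\<Sum>k\<le>m. real k * (catalan k * catalan (m - k))) = real m * S m" .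
    then show "2 * (\<Sum>k\<le>m. (real k + 1) * (catalan k * catalan (m - k))) = (real m + 2) * S m"
      by (simp add: distrib_right sum.distrib S_def)
  qed
  have "(\<Sum>k\<le>Suc n. (real k + 1) * (catalan k * catalan (Suc n - k))) =
      catalan (Suc n) + (\<Sum>k\<le>n. (real k + 2) * catalan (Suc k) * catalan (n - k))"
    by (subst sum.atMost_Suc_shift) (simp add: catalan_def[of 0] mult.assoc add_ac)
  also have "\<dots> = catalan (Suc n) + (\<Sum>k\<le>n. (4 * real k + 2) * (catalan k * catalan (n - k)))"
    by (simp add: catalan_Suc mult.assoc)
  also have "(\<Sum>k\<le>n. (4 * real k + 2) * (catalan k * catalan (n - k))) =
      2 * (2 * (\<Sum>k\<le>n. (real k + 1) * (catalan k * catalan (n - k)))) - 2 * S n"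
    unfolding S_def sum_distrib_left sum_subtractf[symmetric] by (intro sum.cong) (auto simp: algebra_simps)
  also have "\<dots> = (2 * real n + 2) * S n" unfolding half by (simp add: algebra_simps)
  finally have "(real n + 3) * S (Suc n) = 2 * (catalan (Suc n) + (2 * real n + 2) * S n)"
    using half[of "Suc n"] by (simp add: algebra_simps)
  also have "\<dots> = (real n + 3) * catalan (Suc (Suc n))"
    using Suc.IH catalan_Suc[of "Suc n"] by (simp add: S_def algebra_simps)
  finally show ?case by (simp add: S_def)
qed

lemma card_plane_binary_trees: "real (card (plane_binary_trees n)) = catalan n"
proof (induction n rule: less_induct)
  case (less n)
  show ?case
  proof (cases n)
    case 0
    have "plane_binary_trees 0 = {Leaf}" by (auto simp: plane_binary_trees_def)
    then show ?thesis by (simp add: 0 catalan_def)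
  next
    case (Suc m)
    have "real (card (plane_binary_trees n)) =
        (\<Sum>k = 1..n. real (card (plane_binary_trees (k - 1))) * real (card (plane_binary_trees (n - k))))"
      using sum_plane_binary_trees[of n "\<lambda>_. 1"] Suc by simp
    also have "\<dots> = (\<Sum>k = 1..n. catalan (k - 1) * catalan (n - k))"
      by (intro sum.cong refl arg_cong2[of _ _ _ _ "(*)"] less) auto
    also have "\<dots> = (\<Sum>k\<le>m. catalan k * catalan (m - k))"
      by (rule sum.reindex_bij_witness[of _ Suc "\<lambda>k. k - 1"]) (auto simp: Suc)
    finally show ?thesis by (simp add: sum_catalan Suc)
  qed
qed

section \<open>From heights of facets to weights of trees\<close>

text \<open>Summation by parts: the difference at \<open>i\<close> occurs in
  \<open>x 1, ..., x i\<close>, hence in \<open>min i k\<close> of the first \<open>k\<close>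
  entries.\<close>

lemma psum_eq_differences:
  assumes "k \<le> Suc n"
  shows "psum x k = (\<Sum>i = 1..n. real (min i k) * (x i - x (Suc i))) + real k * x (Suc n)"
  using assms
proof (induction n arbitrary: k)
  case 0
  then have "k = 0 \<or> k = 1" by auto
  then show ?case by (auto simp: psum_Suc)
next
  case (Suc n)
  show ?case
  proof (cases "k = Suc (Suc n)")
    case True
    have "(\<Sum>i = 1..n. real (min i k) * (x i - x (Suc i))) =
        (\<Sum>i = 1..n. real (min i (Suc n)) * (x i - x (Suc i)))"
      by (intro sum.cong) (auto simp: True)
    moreover have "psum x k = psum x (Suc n) + x (Suc (Suc n))"
      by (simp add: True psum_Suc)
    ultimately show ?thesis
      using Suc.IH[of "Suc n"] by (simp add: True algebra_simps)
  next
    case False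
    then have "k \<le> Suc n" using Suc.prems by simp
    with Suc.IH[OF this] show ?thesis by (simp add: min_absorb2 algebra_simps)
  qed
qed

text \<open>The coefficient \<open>min i k - k i / (n + 1)\<close> is, as a function of
  \<open>i\<close>, a tent that vanishes at 0 and \<open>n + 1\<close> and peaks at
  \<open>i = k\<close> with value \<open>k (n + 1 - k) / (n + 1)\<close>. The minimum defining
  \<open>wt\<close> is the same tent scaled to peak 1.\<close>

lemma height_eq_root_wt:
  assumes "k \<in> {1..n}"
  shows "height (Suc n) x k =
    real k * real (Suc n - k) / real (Suc n) * root_wt n (\<lambda>i. x i - x (Suc i)) k"
proof -
  have coeff: "real (min i k) - real k / real (Suc n) * real i = real k * real (Suc n - k) / real (Suc n) *
      min (real i / real k) ((real n - real i + 1) / (real n - real k + 1))" if "i \<in> {1..n}" for i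
  proof -
    define N where "N = real (Suc n)"
    have N: "0 < N" "real n = N - 1" "real (Suc n - k) = N - real k"
      using assms by (auto simp: N_def of_nat_diff)
    have pos: "0 < real k" "0 < N - real k" using assms by (auto simp: N_def)
    have "real k * (N - real k) / N * min (real i / real k) ((N - real i) / (N - real k)) =
        real (min i k) - real k / N * real i"
    proof (cases "i \<le> k")
      case True
      then have "real i * N \<le> real k * N"
        using N by (intro mult_right_mono) auto
      then have "min (real i / real k) ((N - real i) / (N - real k)) = real i / real k"
        using pos by (intro min_absorb1) (simp add: field_simps)
      then show ?thesis using True pos N(1) by (simp add: field_simps)
    next
      case False
      then have "real k * N \<le> real i * N"
        using N by (intro mult_right_mono) auto
      then have "min (real i / real k) ((N - real i) / (N - real k)) = (N - real i) / (N - real k)"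
        using pos by (intro min_absorb2) (simp add: field_simps)
      moreover have "real k * (N - real k) / N * ((N - real i) / (N - real k)) = real k * (N - real i) / N"
        using pos by simp
      moreover have "\<dots> = real k - real k / N * real i"
        using N(1) by (simp add: right_diff_distrib diff_divide_distrib)
      ultimately show ?thesis using False by simp
    qed
    then show ?thesis unfolding N_def[symmetric] N(2,3) by simp
  qed
  define d where "d = (\<lambda>i. x i - x (Suc i))"
  have "psum x k = (\<Sum>i = 1..n. real (min i k) * d i) + real k * x (Suc n)"
    using assms unfolding d_def by (intro psum_eq_differences) auto
  moreover have "psum x (Suc n) = (\<Sum>i = 1..n. real i * d i) + real (Suc n) * x (Suc n)"
    by (simp add: d_def psum_eq_differences[of "Suc n" n] del: of_nat_Suc)
  ultimately have "height (Suc n) x k =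
      (\<Sum>i = 1..n. real (min i k) * d i) - real k / real (Suc n) * (\<Sum>i = 1..n. real i * d i)"
    by (simp add: height_def distrib_left del: of_nat_Suc)
  also have "\<dots> = (\<Sum>i = 1..n. (real (min i k) - real k / real (Suc n) * real i) * d i)"
    by (simp add: sum_distrib_left sum_subtractf left_diff_distrib mult.assoc)
  also have "\<dots> = real k * real (Suc n - k) / real (Suc n) * root_wt n d k"
    unfolding root_wt_def sum_distrib_left by (intro sum.cong refl) (simp only: coeff mult.assoc)
  finally show ?thesis by (simp only: d_def)
qed

text \<open>A root labeled \<open>k\<close> corresponds to facet type \<open>k\<close>, with
  \<open>k - 1\<close> and \<open>n - k\<close> nodes below it. By induction these subtrees
  contribute factors \<open>k\<close> and \<open>n + 1 - k\<close>, which are just what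
  \<open>height_eq_root_wt\<close> needs to turn \<open>root_wt\<close> into \<open>n + 1\<close>
  times a height.\<close>

lemma sum_tree_weight:
  "(\<Sum>T\<in>plane_binary_trees n. tree_weight T (\<lambda>i. x i - x (Suc i))) = real (Suc n) * nvol (Suc n) x"
proof (induction n arbitrary: x rule: less_induct)
  case (less n)
  define d where "d = (\<lambda>i. x i - x (Suc i))"
  show ?case
  proof (cases "n = 0")
    case True
    have "plane_binary_trees 0 = {Leaf}" by (auto simp: plane_binary_trees_def)
    then show ?thesis by (simp add: True)
  next
    case False
    let ?Z = "\<lambda>n u. \<Sum>T\<in>plane_binary_trees n. tree_weight T u"
    have "?Z n d = (\<Sum>k = 1..n. root_wt n d k / real n * ?Z (k - 1) d * ?Z (n - k) (\<lambda>i. d (i + k)))"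
      using False
    proof (subst sum_plane_binary_trees, simp, intro sum.cong refl)
      fix k assume k: "k \<in> {1..n}"
      have "(\<Sum>l\<in>plane_binary_trees (k - 1). \<Sum>r\<in>plane_binary_trees (n - k). tree_weight \<langle>l, (), r\<rangle> d) =
        (\<Sum>l\<in>plane_binary_trees (k - 1). \<Sum>r\<in>plane_binary_trees (n - k).
           root_wt n d k / real n * tree_weight l d * tree_weight r (\<lambda>i. d (i + k)))"
      proof (intro sum.cong refl)
        fix l r assume "l \<in> plane_binary_trees (k - 1)" "r \<in> plane_binary_trees (n - k)"
        then have "Suc (size l) = k" "Suc (size l + size r) = n"
          using k by (auto simp: plane_binary_trees_def)
        then show "tree_weight \<langle>l, (), r\<rangle> d =
            root_wt n d k / real n * tree_weight l d * tree_weight r (\<lambda>i. d (i + k))"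
          by (simp only: tree_weight_Node)
      qed
      then show "(\<Sum>l\<in>plane_binary_trees (k - 1). \<Sum>r\<in>plane_binary_trees (n - k). tree_weight \<langle>l, (), r\<rangle> d) =
        root_wt n d k / real n * ?Z (k - 1) d * ?Z (n - k) (\<lambda>i. d (i + k))"
        by (simp only: sum_distrib_left[symmetric] sum_distrib_right[symmetric])
    qed
    also have "\<dots> = (\<Sum>k = 1..n. real (Suc n) / real n *
        (height (Suc n) x k * nvol k x * nvol (Suc n - k) (shift k x)))"
    proof (intro sum.cong refl)
      fix k assume k: "k \<in> {1..n}"
      then have "?Z (k - 1) d = real k * nvol k x"
        using less.IH[of "k - 1" x] by (auto simp: d_def)
      moreover have "?Z (n - k) (\<lambda>i. d (i + k)) = real (Suc n - k) * nvol (Suc n - k) (shift k x)"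
        using k less.IH[of "n - k" "shift k x"] by (simp add: d_def shift_def Suc_diff_le)
      moreover have "height (Suc n) x k = real k * real (Suc n - k) / real (Suc n) * root_wt n d k"
        using height_eq_root_wt[OF k, of x] by (simp only: d_def)
      ultimately show "root_wt n d k / real n * ?Z (k - 1) d * ?Z (n - k) (\<lambda>i. d (i + k)) =
        real (Suc n) / real n * (height (Suc n) x k * nvol k x * nvol (Suc n - k) (shift k x))"
        by (simp del: of_nat_Suc)
    qed
    also have "\<dots> = real (Suc n) / real n * ((real (Suc n) - 1) * nvol (Suc n) x)"
      by (subst nvol_rec) (simp_all only: sum_distrib_left atLeastLessThanSuc_atLeastAtMost Suc_le_mono le0 One_nat_def)
    finally show ?thesis using False by (simp add: d_def)
  qed
qed

theorem theorem17p1: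
  fixes n :: nat and x u :: "nat \<Rightarrow> real"
  assumes "n \<ge> 1"
    and "\<And>i. i \<in> {1..n} \<Longrightarrow> x i \<ge> x (i + 1)"
    and "\<And>i. i \<in> {1..n} \<Longrightarrow> u i = x i - x (i + 1)"
  shows "vol_proj n (permutohedron (n + 1) x) =
           (\<Sum>T\<in>plane_binary_trees n.
              fact n / (\<Prod>j = 1..n. real (h j T)) *
              (\<Prod>j = 1..n. \<Sum>i\<in>desc j T. wt T i j * u i)) \<and>
         real (card (plane_binary_trees n)) = 1 / (real n + 1) * real ((2 * n) choose n)"
proof
  have decr: "decr (Suc n) x" using assms(2) by (auto simp: decr_def)
  have "(\<Sum>T\<in>plane_binary_trees n. fact n / (\<Prod>j = 1..n. real (h j T)) *
      (\<Prod>j = 1..n. \<Sum>i\<in>desc j T. wt T i j * u i)) =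
    (\<Sum>T\<in>plane_binary_trees n. fact n * tree_weight T (\<lambda>i. x i - x (Suc i)))"
  proof (intro sum.cong refl)
    fix T assume "T \<in> plane_binary_trees n"
    then have T: "size T = n" by (simp add: plane_binary_trees_def)
    have "(\<Sum>i\<in>desc j T. wt T i j * u i) = (\<Sum>i\<in>desc j T. wt T i j * (x i - x (Suc i)))" for j
      using desc_subset[of j T] assms(3) by (intro sum.cong) (auto simp: T)
    then show "fact n / (\<Prod>j = 1..n. real (h j T)) * (\<Prod>j = 1..n. \<Sum>i\<in>desc j T. wt T i j * u i) =
        fact n * tree_weight T (\<lambda>i. x i - x (Suc i))"
      by (simp add: tree_weight_def T prod_dividef)
  qed
  also have "\<dots> = fact n * (real (Suc n) * nvol (Suc n) x)"
    by (simp only: sum_distrib_left[symmetric] sum_tree_weight)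
  also have "\<dots> = vol_proj n (permutohedron (n + 1) x)"
    by (simp add: vol_proj_permutohedron[OF decr])
  finally show "vol_proj n (permutohedron (n + 1) x) =
      (\<Sum>T\<in>plane_binary_trees n. fact n / (\<Prod>j = 1..n. real (h j T)) *
         (\<Prod>j = 1..n. \<Sum>i\<in>desc j T. wt T i j * u i))" ..
qed (simp add: card_plane_binary_trees catalan_def)

end
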